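(* Let $\Bbbk$ be a field of characteristic $0$, let $n\ge2$, and let $A_n=M_n(\Bbbk)=\mathrm{End}(V_{n-1})$, where $V_{n-1}$ is the $n$-dimensional irreducible $sl_2(\Bbbk)$-module, so that $sl_2(\Bbbk)\subset A_n$. Let $\mathcal F$ be any unital associative $\Bbbk$-algebra. Then an invertible diagonal matrix $D=\mathrm{diag}(f_1,\dots,f_n)$ with $f_1,\dots,f_n\in\mathcal F^\times$ belongs to $G_{sl_2(\Bbbk),A_n}(\mathcal F)\subset GL_n(\mathcal F)$ if and only if $$\Delta^{(k)}(f_1f_2^{-1},\,f_2f_3^{-1},\dots,f_{k+1}f_{k+2}^{-1})\in I_k(\mathcal F)\qquad\text{for } k=1,\dots,n-2 .$$
   Context: For subsets $X,Y$ of an algebra, $XY$ is the linear span of products and $[X,Y]$ the linear span of commutators $xy-yx$. $\mathcal F\otimes_{\Bbbk} M_n(\Bbbk)$ is identified with $M_n(\mathcal F)$. The identification $\mathrm{End}(V_{n-1})=M_n(\Bbbk)$ uses a weight basis in which the standard generators act by $E=\sum_{i=1}^{n-1}iE_{i,i+1}$, $F=\sum_{i=1}^{n-1}(n-i)E_{i+1,i}$, $H=\sum_{i=1}^n(n+1-2i)E_{ii}$, where $E_{ij}$ are the matrix units. $(sl_2(\Bbbk),A_n)(\mathcal F)$ is the Lie subalgebra (commutator bracket) of $M_n(\mathcal F)$ generated by $\mathcal F\otimes sl_2(\Bbbk)$, and $G_{sl_2(\Bbbk),A_n}(\mathcal F)=\{g\in GL_n(\mathcal F): g\cdot(sl_2(\Bbbk),A_n)(\mathcal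 F)\cdot g^{-1}=(sl_2(\Bbbk),A_n)(\mathcal F)\}$. Put $\mathcal F^{(0)}=\mathcal F$, $\mathcal F^{(k)}=[\mathcal F,\mathcal F^{(k-1)}]$ for $k\ge1$; $I_k(\mathcal F)=\sum_{\ell\ge1}\sum_\lambda\mathcal F^{(\lambda_1)}\cdots\mathcal F^{(\lambda_\ell)}$, the inner sum over $\lambda\in(\mathbb Z_{\ge0})^\ell$ with $\lambda_1+\dots+\lambda_\ell=k$; it is a two-sided ideal of $\mathcal F$. For $m_1,\dots,m_{\ell+1}\in\mathcal F$, $\Delta^{(\ell)}(m_1,\dots,m_{\ell+1})=\sum_{k=0}^{\ell}(-1)^k\binom{\ell}{k}m_{k+1}$. *)

theory Defs
  imports Complex_Main "Jordan_Normal_Form.Matrix"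
begin

(* The sort {ring, monoid_mult} describes unital associative rings in which 0 = 1 is allowed,
   so that the zero algebra is covered as well; ring_1 would exclude it. *)
locale k_algebra = vector_space scale
  for scale :: "'k::field_char_0 \<Rightarrow> 'f::{ring,monoid_mult} \<Rightarrow> 'f" +
  assumes scale_mult_left: "scale c x * y = scale c (x * y)"
    and scale_mult_right: "x * scale c y = scale c (x * y)"


section \<open>Units of a possibly noncommutative ring\<close>

definition is_inverse :: "'f::{ring,monoid_mult} \<Rightarrow> 'f \<Rightarrow> bool" where
  "is_inverse x y \<longleftrightarrow> x * y = 1 \<and> y * x = 1"

definition ring_units :: "'f::{ring,monoid_mult} set" where
  "ring_units = {x. \<exists>y. is_inverse x y}"

definition ring_inv :: "'f::{ring,monoid_mult} \<Rightarrow> 'f" where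
  "ring_inv x = (THE y. is_inverse x y)"


section \<open>Products and commutators of subsets, and the ideals $I_k$\<close>

definition set_prod :: "('k::field_char_0 \<Rightarrow> 'f::{ring,monoid_mult} \<Rightarrow> 'f) \<Rightarrow> 'f set \<Rightarrow> 'f set \<Rightarrow> 'f set" where
  "set_prod scale X Y = module.span scale {x * y | x y. x \<in> X \<and> y \<in> Y}"

definition set_comm :: "('k::field_char_0 \<Rightarrow> 'f::{ring,monoid_mult} \<Rightarrow> 'f) \<Rightarrow> 'f set \<Rightarrow> 'f set \<Rightarrow> 'f set" where
  "set_comm scale X Y = module.span scale {x * y - y * x | x y. x \<in> X \<and> y \<in> Y}"

primrec comm_power :: "('k::field_char_0 \<Rightarrow> 'f::{ring,monoid_mult} \<Rightarrow> 'f) \<Rightarrow> nat \<Rightarrow> 'f set" where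
  "comm_power scale 0 = UNIV"
| "comm_power scale (Suc k) = set_comm scale UNIV (comm_power scale k)"

(* The value on the empty list is the empty product; ideal_I only uses nonempty lists. *)
fun list_set_prod :: "('k::field_char_0 \<Rightarrow> 'f::{ring,monoid_mult} \<Rightarrow> 'f) \<Rightarrow> 'f set list \<Rightarrow> 'f set" where
  "list_set_prod scale [] = module.span scale {1}"
| "list_set_prod scale [X] = X"
| "list_set_prod scale (X # Y # Xs) = set_prod scale X (list_set_prod scale (Y # Xs))"

(* The sum of a family of subspaces is rendered as the span of their union. *)
definition ideal_I :: "('k::field_char_0 \<Rightarrow> 'f::{ring,monoid_mult} \<Rightarrow> 'f) \<Rightarrow> nat \<Rightarrow> 'f set" where
  "ideal_I scale k = module.span scale
     (\<Union>l \<in> {l :: nat list. length l \<ge> 1 \<and> sum_list l = k}. list_set_prod scale (map (comm_power scale) l))"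

(* The sequence m is indexed from 1; only m 1, ..., m (l + 1) are used. *)
definition Delta :: "('k::field_char_0 \<Rightarrow> 'f::{ring,monoid_mult} \<Rightarrow> 'f) \<Rightarrow> nat \<Rightarrow> (nat \<Rightarrow> 'f) \<Rightarrow> 'f" where
  "Delta scale l m = (\<Sum>k=0..l. scale ((- 1) ^ k * of_nat (l choose k)) (m (k + 1)))"


section \<open>The principal $sl_2$ in $M_n(k)$\<close>

(* Matrix entries are indexed from 0, so row or column i here is i + 1 in the weight basis. *)
definition sl2_E :: "nat \<Rightarrow> 'k::field_char_0 mat" where
  "sl2_E n = mat n n (\<lambda>(i,j). if j = i + 1 then of_nat (i + 1) else 0)"

definition sl2_F :: "nat \<Rightarrow> 'k::field_char_0 mat" where
  "sl2_F n = mat n n (\<lambda>(i,j). if i = j + 1 then of_nat n - of_nat (j + 1) else 0)"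

definition sl2_H :: "nat \<Rightarrow> 'k::field_char_0 mat" where
  "sl2_H n = mat n n (\<lambda>(i,j). if i = j then of_nat n + 1 - 2 * of_nat (i + 1) else 0)"

inductive_set mat_span :: "('k::field_char_0 \<Rightarrow> 'a::{ring,monoid_mult} \<Rightarrow> 'a) \<Rightarrow> nat \<Rightarrow> 'a mat set \<Rightarrow> 'a mat set"
  for scale n S where
  zero: "0\<^sub>m n n \<in> mat_span scale n S"
| base: "X \<in> S \<Longrightarrow> X \<in> mat_span scale n S"
| add: "X \<in> mat_span scale n S \<Longrightarrow> Y \<in> mat_span scale n S \<Longrightarrow> X + Y \<in> mat_span scale n S"
| scale: "X \<in> mat_span scale n S \<Longrightarrow> map_mat (scale c) X \<in> mat_span scale n S"

definition sl2_mats :: "nat \<Rightarrow> 'k::field_char_0 mat set" where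
  "sl2_mats n = mat_span (*) n {sl2_E n, sl2_F n, sl2_H n}"


section \<open>The Lie algebra $(g, A_n)(F)$ and the group $G_{g, A_n}(F)$ for $g \subseteq M_n(k)$\<close>

(* The image of the pure tensor of f and X under the identification of the tensor product
   with the matrices over the algebra. *)
definition tensor_mat :: "('k::field_char_0 \<Rightarrow> 'f::{ring,monoid_mult} \<Rightarrow> 'f) \<Rightarrow> 'f \<Rightarrow> 'k mat \<Rightarrow> 'f mat" where
  "tensor_mat scale f X = map_mat (\<lambda>c. scale c f) X"

definition tensor_space :: "('k::field_char_0 \<Rightarrow> 'f::{ring,monoid_mult} \<Rightarrow> 'f) \<Rightarrow> nat \<Rightarrow> 'k mat set \<Rightarrow> 'f mat set" where
  "tensor_space scale n g = mat_span scale n {tensor_mat scale f X | f X. X \<in> g}"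

inductive_set lie_generated :: "('k::field_char_0 \<Rightarrow> 'f::{ring,monoid_mult} \<Rightarrow> 'f) \<Rightarrow> nat \<Rightarrow> 'f mat set \<Rightarrow> 'f mat set"
  for scale n S where
  zero: "0\<^sub>m n n \<in> lie_generated scale n S"
| base: "X \<in> S \<Longrightarrow> X \<in> lie_generated scale n S"
| add: "X \<in> lie_generated scale n S \<Longrightarrow> Y \<in> lie_generated scale n S \<Longrightarrow> X + Y \<in> lie_generated scale n S"
| scale: "X \<in> lie_generated scale n S \<Longrightarrow> map_mat (scale c) X \<in> lie_generated scale n S"
| bracket: "X \<in> lie_generated scale n S \<Longrightarrow> Y \<in> lie_generated scale n S
    \<Longrightarrow> X * Y - Y * X \<in> lie_generated scale n S"

definition lie_alg :: "('k::field_char_0 \<Rightarrow> 'f::{ring,monoid_mult} \<Rightarrow> 'f) \<Rightarrow> nat \<Rightarrow> 'k mat set \<Rightarrow> 'f mat set" where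
  "lie_alg scale n g = lie_generated scale n (tensor_space scale n g)"

(* The matrix h is the inverse of x, so the first three conditions say that x is in GL_n. *)
definition lie_group :: "('k::field_char_0 \<Rightarrow> 'f::{ring,monoid_mult} \<Rightarrow> 'f) \<Rightarrow> nat \<Rightarrow> 'k mat set \<Rightarrow> 'f mat set" where
  "lie_group scale n g = {x \<in> carrier_mat n n. \<exists>h \<in> carrier_mat n n.
      x * h = 1\<^sub>m n \<and> h * x = 1\<^sub>m n \<and> (\<lambda>y. x * y * h) ` lie_alg scale n g = lie_alg scale n g}"

end

(* Call a sequence m_1, ..., m_(n-1) filtered if all its k-th differences lie in I_k. The matrix with
   superdiagonal entries i * m_i lies in L = (sl2, A_n)(F) if and only if m is filtered.
   For "only if", L is contained in the span of the I_j (x) A_(j+1), where A_j is spanned by the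
   products of at most j elements of sl2: this span is a Lie algebra since
   [c X, d Y] = [c, d] X Y + d c [X, Y] and [I_a, I_b] is contained in I_(a+b+1), and the
   superdiagonals of A_(j+1) are i * q(i) with q a polynomial of degree at most j.
   For "if", brackets with F (x) sl2 produce I_k (x) E q(H) for deg q <= k by induction on k, because
   I_(k+1) is spanned by F [F, I_k].
   Conjugating 1 (x) E by D gives the sequence r_i = f_i f_(i+1)^-1, hence the condition is
   necessary. Conversely filtered sequences are closed under products and pointwise inverses, and, if
   r is filtered, also under conjugation by the f_i; so D and D^-1 conjugate F (x) E and F (x) F,
   which generate L, into L. *)
theory Submission
  imports Defs
begin

section \<open>Filtration by the ideals $I_k$\<close>

text \<open>In each bracket used to generate L, the part with coefficient [c, b] has polynomial
  degree one more than the part with coefficient b c. To gain a degree for b c, two brackets are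
  combined so that their leading terms in [c, b] cancel. Only leading coefficients have to be
  computed: all polynomials of smaller degree together with one of exact degree d give all of degree
  at most d.

  In the upper bound, X in A_(a+1) and Y in A_(b+1) have X Y only in A_(a+b+2). The gain of one
  degree in [I_a, I_b] pays for this, while [X, Y] drops back to A_(a+b+1).

  For the group, D L D^-1 must equal L, so the filtered property has to pass to the sequence f_i^-1
  f_(i+1) of D^-1. It is the inverse of r conjugated by the varying units f_i; that conjugation is
  where commutators of filtered sequences enter.\<close>

context k_algebra
begin

lemma subspace_vimage:
  assumes "subspace V" "\<And>a b. h (a + b) = h a + h b" "\<And>c a. h (scale c a) = scale c (h a)"
  shows "subspace {x. h x \<in> V}"
proof -
  have "h 0 = 0" using assms(3)[of 0 0] by simp
  then show ?thesis using assms by (auto simp: subspace_def)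
qed

lemma span_image_mem:
  assumes "x \<in> span A" "subspace V" "\<And>a. a \<in> A \<Longrightarrow> h a \<in> V"
    and "\<And>a b. h (a + b) = h a + h b" "\<And>c a. h (scale c a) = scale c (h a)"
  shows "h x \<in> V"
  using span_minimal[OF _ subspace_vimage[OF assms(2,4,5)], of A] assms(1,3) by auto

abbreviation "C \<equiv> comm_power scale"
abbreviation "I \<equiv> ideal_I scale"
abbreviation "lsp l \<equiv> list_set_prod scale (map C l)"

lemma subspace_ideal_I: "subspace (I k)"
  by (simp add: ideal_I_def)

lemmas ideal_I_add = subspace_add[OF subspace_ideal_I]
  and ideal_I_diff = subspace_diff[OF subspace_ideal_I]
  and ideal_I_scale = subspace_scale[OF subspace_ideal_I]
  and ideal_I_zero = subspace_0[OF subspace_ideal_I]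

lemma list_set_prod_Cons_mem:
  assumes "a \<in> C j" "u \<in> lsp l" "l \<noteq> []"
  shows "a * u \<in> lsp (j # l)"
  using assms by (cases l) (auto simp: set_prod_def intro!: span_base)

lemma ideal_I_memI: "u \<in> lsp l \<Longrightarrow> l \<noteq> [] \<Longrightarrow> sum_list l = k \<Longrightarrow> u \<in> I k"
  unfolding ideal_I_def by (rule span_base) (auto simp: Suc_le_eq)

lemma comm_power_le_ideal_I: "a \<in> C j \<Longrightarrow> a \<in> I j"
  by (rule ideal_I_memI[of _ "[j]"]) auto

lemma ideal_I_0 [simp]: "I 0 = UNIV"
  using comm_power_le_ideal_I[of _ 0] by auto

lemma ideal_I_span_induct:
  assumes "u \<in> I k" "subspace V"
    and "\<And>l u. l \<noteq> [] \<Longrightarrow> sum_list l = k \<Longrightarrow> u \<in> lsp l \<Longrightarrow> u \<in> V"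
  shows "u \<in> V"
proof -
  have "I k \<subseteq> V" unfolding ideal_I_def
  proof (rule span_minimal, safe)
    fix l u assume "u \<in> lsp l" "1 \<le> length l" "k = sum_list l"
    then show "u \<in> V" using assms(3)[of l u] by (cases l) auto
  qed (rule assms(2))
  with assms(1) show ?thesis by auto
qed

lemma list_set_prod_induct:
  assumes "l \<noteq> []" "u \<in> lsp l" "\<And>k. subspace (V k)"
    and "\<And>j a. a \<in> C j \<Longrightarrow> a \<in> V j"
    and "\<And>j k a u. a \<in> C j \<Longrightarrow> u \<in> V k \<Longrightarrow> u \<in> I k \<Longrightarrow> a * u \<in> V (j + k)"
  shows "u \<in> V (sum_list l)"
  using assms(1,2)
proof (induction l arbitrary: u)
  case (Cons j l)
  show ?case
  proof (cases l)
    case Nil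
    then show ?thesis using Cons.prems assms(4) by simp
  next
    case (Cons i l')
    have "u \<in> span {x * y | x y. x \<in> C j \<and> y \<in> lsp l}"
      using Cons.prems(2) Cons by (simp add: set_prod_def)
    then show ?thesis
    proof (rule span_image_mem[where h = "\<lambda>x. x"])
      show "subspace (V (sum_list (j # l)))" by (rule assms(3))
      fix a assume "a \<in> {x * y |x y. x \<in> C j \<and> y \<in> lsp l}"
      then obtain x y where a: "a = x * y" "x \<in> C j" "y \<in> lsp l" by auto
      have "y \<in> V (sum_list l)" using Cons.IH a Cons by simp
      then show "a \<in> V (sum_list (j # l))"
        using assms(5)[OF a(2), of y "sum_list l"] ideal_I_memI[OF a(3), of "sum_list l"] a(1) Cons
        by auto
    qed auto
  qed
qed simp

text \<open>Induction on the number of factors in a spanning product. The step also offers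
  \<open>u \<in> I k\<close>, because the Leibniz arguments below need membership of
  \<open>u\<close> itself besides the claim for it.\<close>

lemma ideal_I_induct [consumes 1, case_names subspace base step]:
  assumes "u \<in> I k" and sub: "\<And>k. subspace (V k)"
    and base: "\<And>j a. a \<in> C j \<Longrightarrow> a \<in> V j"
    and step: "\<And>j k a u. a \<in> C j \<Longrightarrow> u \<in> V k \<Longrightarrow> u \<in> I k \<Longrightarrow> a * u \<in> V (j + k)"
  shows "u \<in> V k"
  using list_set_prod_induct[of _ _ V, OF _ _ sub base step]
  by (intro ideal_I_span_induct[OF assms(1) sub]) auto

lemmas scale_mult = scale_mult_left scale_mult_right

lemma comm_power_mult_ideal_I:
  assumes "a \<in> C j" "v \<in> I b"
  shows "a * v \<in> I (j + b)"
proof -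
  have "subspace {v. a * v \<in> I (j + b)}"
    by (rule subspace_vimage) (auto simp: subspace_ideal_I distrib_left scale_mult)
  from ideal_I_span_induct[OF assms(2) this] show ?thesis
    using list_set_prod_Cons_mem[OF assms(1)] ideal_I_memI[of _ "j # _"] by fastforce
qed

lemma ideal_I_mult:
  assumes "u \<in> I a" "v \<in> I b"
  shows "u * v \<in> I (a + b)"
proof -
  have "u \<in> {u. u * v \<in> I (a + b)}"
    using assms(1)
  proof (induction rule: ideal_I_induct)
    case (subspace k)
    show ?case by (rule subspace_vimage) (auto simp: subspace_ideal_I distrib_right scale_mult)
  next
    case (base j a)
    then show ?case using comm_power_mult_ideal_I assms(2) by auto
  next
    case (step j k a u)
    then show ?case using comm_power_mult_ideal_I[of a j "u * v" "k + b"]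
      by (simp add: mult.assoc add.assoc)
  qed
  then show ?thesis by simp
qed

lemma ideal_I_mult_left: "v \<in> I b \<Longrightarrow> u * v \<in> I b"
  and ideal_I_mult_right: "u \<in> I b \<Longrightarrow> u * v \<in> I b"
  using ideal_I_mult[of u 0 v b] ideal_I_mult[of u b v 0] by auto

section \<open>Commutators raise the degree\<close>

lemma subspace_comm_vimage:
  assumes "subspace V"
  shows "subspace {u. u * w - w * u \<in> V}"
  by (rule subspace_vimage)
    (auto simp: assms algebra_simps scale_mult scale_right_diff_distrib)

lemma comm_swap_mem: "subspace V \<Longrightarrow> x * y - y * x \<in> V \<longleftrightarrow> y * x - x * y \<in> V"
  for x y :: 'f
  using subspace_neg[of V "x * y - y * x"] subspace_neg[of V "y * x - x * y"] by auto

text \<open>Bracketing with \<open>x\<close> is a derivation, and on a factor in \<open>C j\<close>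
  it lands in \<open>C (Suc j)\<close> by definition; so each term of the Leibniz rule has one extra
  degree.\<close>

lemma ideal_I_comm_Suc:
  assumes "u \<in> I k"
  shows "u * x - x * u \<in> I (Suc k)"
proof -
  have "u \<in> {u. u * x - x * u \<in> I (Suc k)}"
    using assms
  proof (induction rule: ideal_I_induct)
    case (subspace k)
    show ?case by (rule subspace_comm_vimage[OF subspace_ideal_I])
  next
    case (base j a)
    have "x * a - a * x \<in> C (Suc j)"
      using base by (auto simp: set_comm_def intro: span_base)
    then show ?case
      using comm_power_le_ideal_I comm_swap_mem[OF subspace_ideal_I] by blast
  next
    case (step j k a u)
    have "x * a - a * x \<in> C (Suc j)"
      using step by (auto simp: set_comm_def intro: span_base)
    then have 1: "(x * a - a * x) * u \<in> I (Suc (j + k))"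
      using comm_power_mult_ideal_I[of _ "Suc j" u k] step.hyps(2) by simp
    have 2: "a * (u * x - x * u) \<in> I (Suc (j + k))"
      using comm_power_mult_ideal_I[OF step.hyps(1), of _ "Suc k"] step.IH by simp
    have "(a * u) * x - x * (a * u) = a * (u * x - x * u) - (x * a - a * x) * u"
      by (simp add: algebra_simps)
    with ideal_I_diff[OF 2 1] show ?case by simp
  qed
  then show ?thesis by simp
qed

text \<open>Gains one degree over the two products taken separately. The commutators that make up
  \<open>a\<close> are moved onto \<open>w\<close> one at a time.\<close>

lemma comm_power_comm_ideal_I:
  assumes "a \<in> C j" "w \<in> I b"
  shows "a * w - w * a \<in> I (Suc (j + b))"
  using assms
proof (induction j arbitrary: a w b)
  case 0
  then show ?case
    using ideal_I_comm_Suc[of w b a] comm_swap_mem[OF subspace_ideal_I, of a w "Suc b"] by simp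
next
  case (Suc j)
  have "a \<in> span {x * y - y * x |x y. x \<in> UNIV \<and> y \<in> C j}"
    using Suc.prems by (simp add: set_comm_def)
  then show ?case
  proof (rule span_image_mem[where h = "\<lambda>a. a * w - w * a"])
    fix a assume "a \<in> {x * y - y * x |x y. x \<in> UNIV \<and> y \<in> C j}"
    then obtain x y where a: "a = x * y - y * x" "y \<in> C j" by auto
    have 1: "y * w - w * y \<in> I (Suc (j + b))" using Suc.IH a Suc.prems by blast
    have 2: "w * x - x * w \<in> I (Suc b)" by (rule ideal_I_comm_Suc[OF Suc.prems(2)])
    have 3: "y * (w * x - x * w) - (w * x - x * w) * y \<in> I (Suc (j + Suc b))"
      using Suc.IH[OF a(2) 2] .
    have 4: "(y * w - w * y) * x - x * (y * w - w * y) \<in> I (Suc (Suc (j + b)))"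
      using ideal_I_comm_Suc[OF 1] .
    \<comment> \<open>Jacobi identity: [[x, y], w] = [y, [w, x]] - [[y, w], x].\<close>
    have "a * w - w * a = (y * (w * x - x * w) - (w * x - x * w) * y)
        - ((y * w - w * y) * x - x * (y * w - w * y))"
      by (simp add: a(1) algebra_simps)
    then show "a * w - w * a \<in> I (Suc (Suc j + b))"
      using ideal_I_diff[OF _ 4] 3 by simp
  qed (auto simp: subspace_ideal_I algebra_simps scale_mult scale_right_diff_distrib)
qed

lemma ideal_I_comm:
  assumes "u \<in> I a" "w \<in> I b"
  shows "u * w - w * u \<in> I (Suc (a + b))"
proof -
  have "u \<in> {u. u * w - w * u \<in> I (Suc (a + b))}"
    using assms(1)
  proof (induction rule: ideal_I_induct)
    case (subspace k)
    show ?case by (rule subspace_comm_vimage[OF subspace_ideal_I])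
  next
    case (base j a)
    then show ?case using comm_power_comm_ideal_I assms(2) by simp
  next
    case (step j k a u)
    have 1: "a * (u * w - w * u) \<in> I (Suc (j + k + b))"
      using comm_power_mult_ideal_I[OF step.hyps(1), of "u * w - w * u" "Suc (k + b)"] step.IH
      by (simp add: add.assoc)
    have 2: "(a * w - w * a) * u \<in> I (Suc (j + k + b))"
      using ideal_I_mult[OF comm_power_comm_ideal_I[OF step.hyps(1) assms(2)] step.hyps(2)]
      by (simp add: ac_simps)
    have "(a * u) * w - w * (a * u) = a * (u * w - w * u) + (a * w - w * a) * u"
      by (simp add: algebra_simps)
    with ideal_I_add[OF 1 2] show ?case by simp
  qed
  then show ?thesis by simp
qed

section \<open>A spanning set of commutators for I_(k+1)\<close>

definition comm_ideal :: "nat \<Rightarrow> 'f set" where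
  "comm_ideal k = span {b * (c * x - x * c) | b c x. c \<in> I k}"

lemma comm_ideal_mult_left:
  assumes "u \<in> comm_ideal k"
  shows "a * u \<in> comm_ideal k"
  using assms unfolding comm_ideal_def
proof (rule span_image_mem[where h = "\<lambda>u. a * u"])
  fix u assume "u \<in> {b * (c * x - x * c) |b c x. c \<in> I k}"
  then obtain b c x where "u = b * (c * x - x * c)" "c \<in> I k" by auto
  then have "a * u = (a * b) * (c * x - x * c)" by (simp add: mult.assoc)
  then show "a * u \<in> span {b * (c * x - x * c) |b c x. c \<in> I k}"
    using \<open>c \<in> I k\<close> by (intro span_base) blast
qed (auto simp: distrib_left scale_mult)

lemma comm_ideal_base: "c \<in> I k \<Longrightarrow> b * (c * x - x * c) \<in> comm_ideal k"
  unfolding comm_ideal_def by (intro span_base) blast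

text \<open>The identity [x, y] u = y [u, x] - [y u, x] replaces a commutator on the left by
  commutators on the right. For deeper \<open>a\<close>, the term y [u, x] falls under the induction
  hypothesis with \<open>m\<close> raised by one.\<close>

lemma comm_power_mult_comm_ideal:
  assumes "a \<in> C (Suc j)" "u \<in> I m"
  shows "a * u \<in> comm_ideal (j + m)"
  using assms
proof (induction j arbitrary: a u m)
  case (0 a u m)
  from 0 have "a \<in> span {x * y - y * x |x y. x \<in> UNIV \<and> y \<in> C 0}"
    by (simp add: set_comm_def)
  then show ?case
  proof (rule span_image_mem[where h = "\<lambda>a. a * u"])
    fix a :: 'f assume "a \<in> {x * y - y * x |x y. x \<in> UNIV \<and> y \<in> C 0}"
    then obtain x y where a: "a = x * y - y * x" by auto
    have "a * u = y * (u * x - x * u) - 1 * ((y * u) * x - x * (y * u))"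
      by (simp add: a algebra_simps)
    also have "\<dots> \<in> comm_ideal m"
      using comm_ideal_base[OF 0(2), of y x] comm_ideal_base[OF ideal_I_mult_left[OF 0(2)], of 1 y x]
      unfolding comm_ideal_def by (intro span_diff)
    finally show "a * u \<in> comm_ideal (0 + m)" by simp
  qed (auto simp: comm_ideal_def algebra_simps scale_mult)
next
  case (Suc j a u m)
  from Suc.prems have "a \<in> span {x * y - y * x |x y. x \<in> UNIV \<and> y \<in> C (Suc j)}"
    by (simp add: set_comm_def)
  then show ?case
  proof (rule span_image_mem[where h = "\<lambda>a. a * u"])
    fix a :: 'f assume "a \<in> {x * y - y * x |x y. x \<in> UNIV \<and> y \<in> C (Suc j)}"
    then obtain x y where a: "a = x * y - y * x" "y \<in> C (Suc j)" by auto
    have 1: "y * (u * x - x * u) \<in> comm_ideal (Suc j + m)"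
      using Suc.IH[OF a(2) ideal_I_comm_Suc[OF Suc.prems(2)]] by simp
    have "y * u \<in> I (Suc j + m)" by (rule comm_power_mult_ideal_I[OF a(2) Suc.prems(2)])
    from comm_ideal_base[OF this, of 1 x] 1
    have "y * (u * x - x * u) - 1 * ((y * u) * x - x * (y * u)) \<in> comm_ideal (Suc j + m)"
      unfolding comm_ideal_def by (intro span_diff)
    moreover have "a * u = y * (u * x - x * u) - 1 * ((y * u) * x - x * (y * u))"
      by (simp add: a algebra_simps)
    ultimately show "a * u \<in> comm_ideal (Suc j + m)" by simp
  qed (auto simp: comm_ideal_def algebra_simps scale_mult)
qed

text \<open>Reduces linear claims about I_(k+1) to the elements b [c, x] with c in I_k.\<close>

lemma ideal_I_Suc_le_comm_ideal:
  assumes "u \<in> I (Suc k)"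
  shows "u \<in> comm_ideal k"
proof -
  \<comment> \<open>The induction ranges over all degrees, so degree 0 gets the trivial value.
    Factors of degree 0 are absorbed because \<open>comm_ideal\<close> is closed under left
    multiplication.\<close>
  define V where "V m = (case m of 0 \<Rightarrow> UNIV | Suc k \<Rightarrow> comm_ideal k)" for m
  have "u \<in> V (Suc k)"
    using assms
  proof (induction rule: ideal_I_induct)
    case (subspace k)
    show ?case by (auto simp: V_def comm_ideal_def split: nat.split)
  next
    case (base j a)
    show ?case
    proof (cases j)
      case (Suc j')
      then show ?thesis using comm_power_mult_comm_ideal[of a j' 1 0] base by (simp add: V_def)
    qed (simp add: V_def)
  next
    case (step j m a u)
    show ?case
    proof (cases j)
      case 0
      then show ?thesis using step comm_ideal_mult_left by (auto simp: V_def split: nat.split)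
    next
      case (Suc j')
      then show ?thesis using comm_power_mult_comm_ideal[of a j' u m] step by (simp add: V_def)
    qed
  qed
  then show ?thesis by (simp add: V_def)
qed

lemma ideal_I_Suc_subset: "I (Suc k) \<subseteq> I k"
proof
  fix u assume "u \<in> I (Suc k)"
  from ideal_I_Suc_le_comm_ideal[OF this]
  have "u \<in> span {b * (c * x - x * c) | b c x. c \<in> I k}" by (simp add: comm_ideal_def)
  moreover have "span {b * (c * x - x * c) | b c x. c \<in> I k} \<subseteq> I k"
    by (rule span_minimal)
      (use ideal_I_mult_left ideal_I_mult_right ideal_I_diff subspace_ideal_I in \<open>blast+\<close>)
  ultimately show "u \<in> I k" by blast
qed

lemma ideal_I_antimono: "j \<le> k \<Longrightarrow> I k \<subseteq> I j"
  by (induction rule: dec_induct) (use ideal_I_Suc_subset in auto)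

end

section \<open>Filtered sequences\<close>

definition fdiff :: "(nat \<Rightarrow> 'a::ab_group_add) \<Rightarrow> nat \<Rightarrow> 'a" where
  "fdiff m i = m (Suc i) - m i"

context k_algebra
begin

text \<open>Only \<open>m 0\<close>, ..., \<open>m (N - 1)\<close> count, and differences of order d
  are required to lie in \<open>I (p + d)\<close>. The offset \<open>p\<close> lets the recursion
  restart on \<open>fdiff m\<close> and makes the levels of products add up.\<close>

primrec filt :: "nat \<Rightarrow> nat \<Rightarrow> (nat \<Rightarrow> 'f) \<Rightarrow> bool" where
  "filt 0 p m \<longleftrightarrow> True"
| "filt (Suc N) p m \<longleftrightarrow> (\<forall>i\<le>N. m i \<in> I p) \<and> filt N (Suc p) (fdiff m)"

lemma filt_cong: "(\<And>i. i < N \<Longrightarrow> m i = m' i) \<Longrightarrow> filt N p m = filt N p m'"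
proof (induction N arbitrary: p m m')
  case (Suc N)
  have "filt N (Suc p) (fdiff m) = filt N (Suc p) (fdiff m')"
    by (rule Suc.IH) (simp add: fdiff_def Suc.prems)
  then show ?case using Suc.prems by simp
qed simp

lemma filt_mono: "filt N p m \<Longrightarrow> M \<le> N \<Longrightarrow> filt M p m"
proof (induction M arbitrary: N p m)
  case (Suc M)
  then show ?case by (cases N) auto
qed simp

lemma filt_add: "filt N p u \<Longrightarrow> filt N p v \<Longrightarrow> filt N p (\<lambda>i. u i + v i)"
proof (induction N arbitrary: p u v)
  case (Suc N)
  have "fdiff (\<lambda>i. u i + v i) = (\<lambda>i. fdiff u i + fdiff v i)"
    by (simp add: fdiff_def fun_eq_iff)
  then show ?case using Suc by (auto intro: ideal_I_add)
qed simp

lemma filt_scale: "filt N p u \<Longrightarrow> filt N p (\<lambda>i. scale c (u i))"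
proof (induction N arbitrary: p u)
  case (Suc N)
  have "fdiff (\<lambda>i. scale c (u i)) = (\<lambda>i. scale c (fdiff u i))"
    by (simp add: fdiff_def fun_eq_iff scale_right_diff_distrib)
  then show ?case using Suc by (auto intro: ideal_I_scale)
qed simp

lemma filt_uminus: "filt N p u \<Longrightarrow> filt N p (\<lambda>i. - u i)"
  using filt_scale[of N p u "- 1"] by simp

lemma filt_Suc: "filt (Suc N) p u \<Longrightarrow> filt N p (\<lambda>i. u (Suc i))"
proof (induction N arbitrary: p u)
  case (Suc N)
  have "fdiff (\<lambda>i. u (Suc i)) = (\<lambda>i. fdiff u (Suc i))"
    by (simp add: fdiff_def fun_eq_iff)
  then show ?case using Suc by auto
qed simp

text \<open>Discrete Leibniz rule: the first factor is taken at the shifted index when the second is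
  differenced.\<close>

lemma filt_mult: "filt N p u \<Longrightarrow> filt N q v \<Longrightarrow> filt N (p + q) (\<lambda>i. u i * v i)"
proof (induction N arbitrary: p q u v)
  case (Suc N)
  have eq: "fdiff (\<lambda>i. u i * v i) = (\<lambda>i. fdiff u i * v i + u (Suc i) * fdiff v i)"
    by (simp add: fdiff_def fun_eq_iff algebra_simps)
  have "filt N (Suc p + q) (\<lambda>i. fdiff u i * v i)"
    using Suc.prems filt_mono[OF Suc.prems(2), of N] by (intro Suc.IH) auto
  moreover have "filt N (p + Suc q) (\<lambda>i. u (Suc i) * fdiff v i)"
    using Suc.prems filt_Suc[OF Suc.prems(1)] by (intro Suc.IH) auto
  ultimately show ?case
    using Suc.prems filt_add[of N "Suc (p + q)"] by (auto simp: eq intro: ideal_I_mult)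
qed simp

lemma filt_comm:
  "filt N p u \<Longrightarrow> filt N q v \<Longrightarrow> filt N (Suc (p + q)) (\<lambda>i. u i * v i - v i * u i)"
proof (induction N arbitrary: p q u v)
  case (Suc N)
  have eq: "fdiff (\<lambda>i. u i * v i - v i * u i) = (\<lambda>i. (fdiff u i * v i - v i * fdiff u i)
      + (u (Suc i) * fdiff v i - fdiff v i * u (Suc i)))"
    by (simp add: fdiff_def fun_eq_iff algebra_simps)
  have "filt N (Suc (Suc p + q)) (\<lambda>i. fdiff u i * v i - v i * fdiff u i)"
    using Suc.prems filt_mono[OF Suc.prems(2), of N] by (intro Suc.IH) auto
  moreover have "filt N (Suc (p + Suc q)) (\<lambda>i. u (Suc i) * fdiff v i - fdiff v i * u (Suc i))"
    using Suc.prems filt_Suc[OF Suc.prems(1)] by (intro Suc.IH) auto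
  ultimately show ?case
    using Suc.prems filt_add[of N "Suc (Suc (p + q))"]
    by (auto simp: eq intro: ideal_I_comm)
qed simp

lemma filt_zero: "filt N p (\<lambda>i. 0)"
proof (induction N arbitrary: p)
  case (Suc N)
  have "fdiff (\<lambda>i. 0 :: 'f) = (\<lambda>i. 0)" by (simp add: fdiff_def fun_eq_iff)
  then show ?case using Suc by (simp add: ideal_I_zero)
qed simp

lemma filt_const: "filt N 0 (\<lambda>i. b)"
proof (cases N)
  case (Suc M)
  have "fdiff (\<lambda>i. b) = (\<lambda>i. 0)" by (simp add: fdiff_def fun_eq_iff)
  then show ?thesis using Suc filt_zero by simp
qed simp

text \<open>The difference of s is - s(i+1) (r(i+1) - r(i)) s(i), which involves s and its shift on
  one term less. Hence the induction on the length, applied to both.\<close>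

lemma filt_inverse:
  "filt N 0 r \<Longrightarrow> (\<And>i. i < N \<Longrightarrow> is_inverse (r i) (s i)) \<Longrightarrow> filt N 0 s"
proof (induction N arbitrary: r s)
  case (Suc N)
  have s: "filt N 0 s"
    by (rule Suc.IH[of r]) (use filt_mono[OF Suc.prems(1), of N] Suc.prems(2) in auto)
  have s': "filt N 0 (\<lambda>i. s (Suc i))"
    by (rule Suc.IH[of "\<lambda>i. r (Suc i)"]) (use filt_Suc[OF Suc.prems(1)] Suc.prems(2) in auto)
  have "filt N (Suc 0) (\<lambda>i. - (s (Suc i) * (fdiff r i * s i)))"
    using Suc.prems(1) filt_mult[OF s' filt_mult[OF _ s, of "Suc 0" "fdiff r"]]
    by (simp add: filt_uminus)
  moreover have "fdiff s i = - (s (Suc i) * (fdiff r i * s i))" if "i < N" for i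
  proof -
    have "s (Suc i) * (r (Suc i) * s i) = s i"
      using Suc.prems(2)[of "Suc i"] that by (simp add: is_inverse_def mult.assoc[symmetric])
    moreover have "r i * s i = 1"
      using Suc.prems(2)[of i] that by (simp add: is_inverse_def)
    ultimately show ?thesis
      by (simp add: fdiff_def left_diff_distrib right_diff_distrib)
  qed
  ultimately have "filt N (Suc 0) (fdiff s)" by (rule iffD2[OF filt_cong, rotated])
  then show ?case by simp
qed simp

(* Conjugation by the varying units g i twists the difference operator only by an inner
   correction: fdiff (g * u * f) = g * w * f with w one step deeper in the filtration. *)
lemma filt_conj:
  assumes inv: "\<And>i. i \<le> N \<Longrightarrow> is_inverse (f i) (g i)"
    and r: "filt N 0 (\<lambda>i. f i * g (Suc i))"
  shows "filt M p u \<Longrightarrow> M \<le> Suc N \<Longrightarrow> filt M p (\<lambda>i. g i * u i * f i)"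
proof (induction M arbitrary: p u)
  case (Suc M)
  define r where "r = (\<lambda>i. f i * g (Suc i))"
  define t where "t = (\<lambda>i. f (Suc i) * g i)"
  have fg: "f i * g i = 1" "g i * f i = 1" if "i \<le> N" for i
    using inv[OF that] by (auto simp: is_inverse_def)
  have fg': "f i * (g i * x) = x" "g i * (f i * x) = x" if "i \<le> N" for i x
    using fg[OF that] by (simp_all add: mult.assoc[symmetric])
  have MN: "M \<le> N" using Suc.prems by simp
  have r: "filt M 0 r" using filt_mono[OF r MN] by (simp add: r_def)
  have t: "filt M 0 t"
  proof (rule filt_inverse[OF r])
    fix i assume "i < M"
    then show "is_inverse (r i) (t i)"
      using MN by (auto simp: is_inverse_def r_def t_def mult.assoc fg fg')
  qed
  \<comment> \<open>Here t inverts r entrywise. From g(i+1) = g(i) r(i) and f(i+1) = t(i) f(i), the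
    difference is g(i) (r(i) u(i+1) t(i) - u(i)) f(i). Writing u = u r t splits the middle into a
    difference of u and a commutator with r.\<close>
  define w where "w = (\<lambda>i. r i * (fdiff u i * t i) + (r i * u i - u i * r i) * t i)"
  have "filt M (Suc p) (\<lambda>i. r i * (fdiff u i * t i))"
    using filt_mult[OF r filt_mult[of M "Suc p" "fdiff u" 0 t]] Suc.prems(1) t by simp
  moreover have "filt M (Suc p) (\<lambda>i. (r i * u i - u i * r i) * t i)"
    using filt_mult[OF filt_comm[OF r filt_mono[OF Suc.prems(1)]] t] by simp
  ultimately have "filt M (Suc p) w" unfolding w_def by (rule filt_add)
  then have "filt M (Suc p) (\<lambda>i. g i * w i * f i)"
    using Suc.IH MN by simp
  moreover have "fdiff (\<lambda>i. g i * u i * f i) i = g i * w i * f i" if "i < M" for i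
    using that MN
    by (simp add: fdiff_def w_def r_def t_def algebra_simps fg fg' mult.assoc)
  ultimately have "filt M (Suc p) (fdiff (\<lambda>i. g i * u i * f i))"
    by (rule iffD2[OF filt_cong, rotated])
  moreover have "g i * u i * f i \<in> I p" if "i \<le> M" for i
    using Suc.prems(1) that by (intro ideal_I_mult_right ideal_I_mult_left) simp
  ultimately show ?case by simp
qed simp

lemma is_inverse_sym: "is_inverse x y \<Longrightarrow> is_inverse y x" for x y :: 'f
  by (auto simp: is_inverse_def)

text \<open>The second sequence is the ratio sequence of the inverse diagonal matrix; it equals g(i)
  t(i) f(i), where t is the pointwise inverse of the given one.\<close>

lemma filt_conj_inverse:
  assumes inv: "\<And>i. i \<le> N \<Longrightarrow> is_inverse (f i) (g i)"
    and r: "filt N 0 (\<lambda>i. f i * g (Suc i))"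
  shows "filt N 0 (\<lambda>i. f (Suc i) * g i)" "filt N 0 (\<lambda>i. g i * f (Suc i))"
proof -
  have fg: "f i * g i = 1" "g i * f i = 1" if "i \<le> N" for i
    using inv[OF that] by (auto simp: is_inverse_def)
  have fg': "f i * (g i * x) = x" "g i * (f i * x) = x" if "i \<le> N" for i x
    using fg[OF that] by (simp_all add: mult.assoc[symmetric])
  show t: "filt N 0 (\<lambda>i. f (Suc i) * g i)"
    by (rule filt_inverse[OF r]) (auto simp: is_inverse_def mult.assoc fg fg')
  have "filt N 0 (\<lambda>i. g i * (f (Suc i) * g i) * f i)"
    by (rule filt_conj[OF inv r t]) auto
  then show "filt N 0 (\<lambda>i. g i * f (Suc i))"
    by (rule iffD1[OF filt_cong, rotated]) (simp add: mult.assoc fg)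
qed

text \<open>These are the entries of D (b (x) E) D^-1 and D (b (x) F) D^-1, up to weights. Each is a
  conjugate of the constant b times a ratio of consecutive units.\<close>

lemma filt_conj_entries:
  assumes inv: "\<And>i. i \<le> N \<Longrightarrow> is_inverse (f i) (g i)"
    and r: "filt N 0 (\<lambda>i. f i * g (Suc i))"
  shows "filt N 0 (\<lambda>i. f i * b * g (Suc i))" "filt N 0 (\<lambda>i. f (Suc i) * b * g i)"
proof -
  have fg: "f i * g i = 1" "g i * f i = 1" if "i \<le> N" for i
    using inv[OF that] by (auto simp: is_inverse_def)
  have fg': "f i * (g i * x) = x" "g i * (f i * x) = x" if "i \<le> N" for i x
    using fg[OF that] by (simp_all add: mult.assoc[symmetric])
  \<comment> \<open>\<open>filt_conj\<close> with f and g exchanged, which asks for the ratio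
    sequence of the inverse matrix.\<close>
  have c: "filt (Suc N) 0 (\<lambda>i. f i * b * g i)"
    by (rule filt_conj[OF _ filt_conj_inverse(2)[OF assms] filt_const])
      (use inv is_inverse_sym in auto)
  have "filt N 0 (\<lambda>i. (f i * b * g i) * (f i * g (Suc i)))"
    using filt_mult[OF filt_mono[OF c] r] by simp
  then show "filt N 0 (\<lambda>i. f i * b * g (Suc i))"
    by (rule iffD1[OF filt_cong, rotated]) (simp add: mult.assoc fg')
  have "filt N 0 (\<lambda>i. (f (Suc i) * b * g (Suc i)) * (f (Suc i) * g i))"
    using filt_mult[OF filt_Suc[OF c] filt_conj_inverse(1)[OF assms]] by simp
  then show "filt N 0 (\<lambda>i. f (Suc i) * b * g i)"
    by (rule iffD1[OF filt_cong, rotated]) (simp add: mult.assoc fg')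
qed

end

section \<open>Polynomial functions and Newton's forward formula\<close>

(* ldc d g c says that g is a polynomial function of degree at most d whose d-th difference
   (d! times the coefficient of degree d) is c; in particular ldc d g 0 means degree < d. *)
primrec ldc :: "nat \<Rightarrow> (nat \<Rightarrow> 'k::field_char_0) \<Rightarrow> 'k \<Rightarrow> bool" where
  "ldc 0 g c \<longleftrightarrow> g = (\<lambda>i. c)"
| "ldc (Suc d) g c \<longleftrightarrow> ldc d (fdiff g) c"

lemma ldc_add: "ldc d g c \<Longrightarrow> ldc d h e \<Longrightarrow> ldc d (\<lambda>i. g i + h i) (c + e)"
proof (induction d arbitrary: g h)
  case (Suc d)
  have "fdiff (\<lambda>i. g i + h i) = (\<lambda>i. fdiff g i + fdiff h i)"
    by (simp add: fdiff_def fun_eq_iff)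
  then show ?case using Suc by simp
qed simp

lemma ldc_cmult: "ldc d g c \<Longrightarrow> ldc d (\<lambda>i. a * g i) (a * c)"
proof (induction d arbitrary: g)
  case (Suc d)
  have "fdiff (\<lambda>i. a * g i) = (\<lambda>i. a * fdiff g i)"
    by (simp add: fdiff_def fun_eq_iff algebra_simps)
  then show ?case using Suc by simp
qed simp

lemma ldc_shift: "ldc d g c \<Longrightarrow> ldc d (\<lambda>i. g (Suc i)) c"
proof (induction d arbitrary: g)
  case (Suc d)
  have "fdiff (\<lambda>i. g (Suc i)) = (\<lambda>i. fdiff g (Suc i))"
    by (simp add: fdiff_def fun_eq_iff)
  then show ?case using Suc by simp
qed simp

text \<open>Lets a polynomial in the column j = i + 1 be prescribed as a polynomial in i.\<close>

lemma ldc_unshift: "ldc d g c \<Longrightarrow> \<exists>g'. ldc d g' c \<and> (\<forall>i. g' (Suc i) = g i)"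
proof (induction d arbitrary: g)
  case 0
  then show ?case by auto
next
  case (Suc d)
  then obtain h where h: "ldc d h c" "\<And>i. h (Suc i) = fdiff g i" by auto
  \<comment> \<open>The value at 0 is forced by the first difference \<open>h 0\<close>.\<close>
  define g' where "g' = case_nat (g 0 - h 0) g"
  have "fdiff g' i = h i" for i
    by (cases i) (auto simp: fdiff_def g'_def h(2))
  then have "fdiff g' = h" by auto
  then have "ldc (Suc d) g' c" using h(1) by simp
  then show ?case by (intro exI[of _ g']) (simp add: g'_def)
qed

lemma ldc_Suc: "ldc d g c \<Longrightarrow> ldc (Suc d) g 0"
proof (induction d arbitrary: g)
  case (Suc d)
  then show ?case by (metis ldc.simps(2))
qed (simp add: fdiff_def fun_eq_iff)

lemma ldc_mono: "d \<le> e \<Longrightarrow> ldc d g 0 \<Longrightarrow> ldc e g 0"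
  by (induction rule: dec_induct) (use ldc_Suc in blast)+

lemma ldc_Suc_ex: "ldc (Suc d) g 0 \<Longrightarrow> \<exists>c. ldc d g c"
proof (induction d arbitrary: g)
  case 0
  have "g (Suc i) = g i" for i using fun_cong[OF 0[simplified], of i] by (simp add: fdiff_def)
  then have "g i = g 0" for i by (induction i) auto
  then show ?case by auto
next
  case (Suc d)
  then show ?case by auto
qed

text \<open>The leading coefficient c / d! becomes b c / d!, and (d + 1)! times this is (d + 1) b
  c.\<close>

lemma ldc_mult_linear:
  "ldc d g c \<Longrightarrow> ldc (Suc d) (\<lambda>i. (a + b * of_nat i) * g i) (of_nat (Suc d) * b * c)"
proof (induction d arbitrary: g c)
  case 0
  then show ?case by (simp add: fdiff_def fun_eq_iff algebra_simps)
next
  case (Suc d)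
  have eq: "fdiff (\<lambda>i. (a + b * of_nat i) * g i)
      = (\<lambda>i. (a + b * of_nat i) * fdiff g i + b * g (Suc i))"
    by (simp add: fdiff_def fun_eq_iff algebra_simps)
  have "ldc (Suc d) (\<lambda>i. (a + b * of_nat i) * fdiff g i) (of_nat (Suc d) * b * c)"
    using Suc by simp
  moreover have "ldc (Suc d) (\<lambda>i. b * g (Suc i)) (b * c)"
    using Suc.prems by (intro ldc_cmult ldc_shift)
  ultimately have "ldc (Suc d) (fdiff (\<lambda>i. (a + b * of_nat i) * g i))
      (of_nat (Suc d) * b * c + b * c)"
    unfolding eq by (rule ldc_add)
  then show ?case by (simp add: algebra_simps)
qed

lemma ldc_binomial: "ldc k (\<lambda>i. of_nat (i choose k)) 1"
proof (induction k)
  case (Suc k)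
  have "fdiff (\<lambda>i. of_nat (i choose Suc k)) = (\<lambda>i. of_nat (i choose k) :: 'a)"
    by (simp add: fdiff_def fun_eq_iff)
  then show ?case using Suc by simp
qed simp

text \<open>One member of W in each exact degree suffices: it removes the leading term, and the
  degree descends.\<close>

lemma ldc_fill:
  assumes add: "\<And>g h. g \<in> W \<Longrightarrow> h \<in> W \<Longrightarrow> (\<lambda>i. g i + h i) \<in> W"
    and cmult: "\<And>a g. g \<in> W \<Longrightarrow> (\<lambda>i. a * g i) \<in> W"
    and zero: "(\<lambda>i. 0) \<in> W"
    and gens: "\<And>k. k < K \<Longrightarrow> \<exists>g\<in>W. \<exists>c. c \<noteq> 0 \<and> ldc k g c"
    and g: "ldc K g 0"
  shows "g \<in> W"
  using gens g
proof (induction K arbitrary: g)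
  case 0
  then show ?case using zero by simp
next
  case (Suc K)
  obtain e where e: "ldc K g e" using ldc_Suc_ex[OF Suc.prems(2)] by auto
  obtain h c where h: "h \<in> W" "c \<noteq> 0" "ldc K h c" using Suc.prems(1)[of K] by auto
  have "ldc K (\<lambda>i. g i + (- e / c) * h i) (e + (- e / c) * c)"
    by (intro ldc_add ldc_cmult e h)
  then have "(\<lambda>i. g i + (- e / c) * h i) \<in> W"
    using Suc h(2) by auto
  from add[OF this cmult[OF h(1), of "e / c"]] show ?case by simp
qed

lemma funpow_fdiff_shift: "(fdiff ^^ k) (\<lambda>i. m (Suc i)) = (\<lambda>i. (fdiff ^^ k) m (Suc i))"
  by (induction k) (auto simp: fdiff_def)

context k_algebra
begin

lemma filt_nth: "filt N p m \<Longrightarrow> i < N \<Longrightarrow> m i \<in> I p"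
  by (cases N) auto

text \<open>Telescoping from index 0: since I_(p+1) lies in I_p, adding differences keeps every
  later entry at level p. This is why the theorem only mentions differences that start at the first
  entry.\<close>

lemma filt_iff_initial: "filt N p m \<longleftrightarrow> (\<forall>k<N. (fdiff ^^ k) m 0 \<in> I (k + p))"
proof (induction N arbitrary: p m)
  case (Suc N)
  have "(\<forall>i\<le>N. m i \<in> I p) \<longleftrightarrow> m 0 \<in> I p" if f: "filt N (Suc p) (fdiff m)"
  proof
    assume 0: "m 0 \<in> I p"
    have "m i \<in> I p" if "i \<le> N" for i
      using that
    proof (induction i)
      case (Suc i)
      have "fdiff m i \<in> I p"
        using filt_nth[OF f, of i] Suc.prems ideal_I_Suc_subset by auto
      then have "m i + fdiff m i \<in> I p" using Suc by (intro ideal_I_add) auto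
      then show ?case by (simp add: fdiff_def)
    qed (use 0 in simp)
    then show "\<forall>i\<le>N. m i \<in> I p" by simp
  qed auto
  then show ?case
    unfolding filt.simps Suc.IH All_less_Suc2
    by (auto simp: funpow_Suc_right simp del: funpow.simps)
qed simp

text \<open>Splits a filtered sequence into polynomials of degree k with coefficients in I_k, the
  form in which membership in L is proved. The induction is Pascal's rule.\<close>

lemma newton_forward:
  "m i = (\<Sum>k\<le>i. scale (of_nat (i choose k)) ((fdiff ^^ k) m 0))"
proof (induction i arbitrary: m)
  case (Suc i)
  have "m (Suc i) = m i + fdiff m i" by (simp add: fdiff_def)
  also have "\<dots> = (\<Sum>k\<le>i. scale (of_nat (i choose k)) ((fdiff ^^ k) m 0))
      + (\<Sum>k\<le>i. scale (of_nat (i choose k)) ((fdiff ^^ Suc k) m 0))"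
    using Suc[of m] Suc[of "fdiff m"] by (simp add: funpow_swap1)
  also have "(\<Sum>k\<le>i. scale (of_nat (i choose k)) ((fdiff ^^ k) m 0))
      = (\<Sum>k\<le>Suc i. scale (of_nat (i choose k)) ((fdiff ^^ k) m 0))"
    by simp
  also have "\<dots> = m 0 + (\<Sum>k\<le>i. scale (of_nat (i choose Suc k)) ((fdiff ^^ Suc k) m 0))"
    by (subst sum.atMost_Suc_shift) simp
  also have "\<dots> + (\<Sum>k\<le>i. scale (of_nat (i choose k)) ((fdiff ^^ Suc k) m 0))
      = (\<Sum>k\<le>Suc i. scale (of_nat (Suc i choose k)) ((fdiff ^^ k) m 0))"
    by (subst sum.atMost_Suc_shift)
      (simp add: sum.distrib[symmetric] scale_left_distrib[symmetric] add.assoc add.commute)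
  finally show ?case .
qed simp

text \<open>\<open>Delta\<close> subtracts later terms from earlier ones, opposite to
  \<open>fdiff\<close>, hence the sign. By Pascal's rule, \<open>Delta\<close> of order l + 1 is
  \<open>Delta\<close> of order l of the sequence minus that of its shift.\<close>

lemma Delta_eq_fdiff: "Delta scale l m = scale ((- 1) ^ l) ((fdiff ^^ l) (\<lambda>i. m (Suc i)) 0)"
proof (induction l arbitrary: m)
  case (Suc l)
  let ?t = "\<lambda>l k. scale ((- 1) ^ k * of_nat (l choose k))"
  have "Delta scale (Suc l) m = (\<Sum>k\<le>Suc l. ?t (Suc l) k (m (k + 1)))"
    by (simp add: Delta_def atMost_atLeast0)
  also have "\<dots> = m 1 + (\<Sum>k\<le>l. ?t (Suc l) (Suc k) (m (Suc k + 1)))"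
    by (subst sum.atMost_Suc_shift) simp
  also have "\<dots> = m 1 + (\<Sum>k\<le>l. ?t l (Suc k) (m (Suc k + 1))) - (\<Sum>k\<le>l. ?t l k (m (Suc k + 1)))"
  proof -
    have "?t (Suc l) (Suc k) x = ?t l (Suc k) x - ?t l k x" for k x
      unfolding scale_left_diff_distrib[symmetric] by (simp add: algebra_simps)
    then show ?thesis by (simp only: sum_subtractf add_diff_eq)
  qed
  also have "m 1 + (\<Sum>k\<le>l. ?t l (Suc k) (m (Suc k + 1))) = (\<Sum>k\<le>Suc l. ?t l k (m (k + 1)))"
    by (subst sum.atMost_Suc_shift) simp
  also have "\<dots> = Delta scale l m"
    by (simp add: Delta_def atMost_atLeast0)
  also have "(\<Sum>k\<le>l. ?t l k (m (Suc k + 1))) = Delta scale l (\<lambda>i. m (Suc i))"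
    by (simp add: Delta_def atMost_atLeast0)
  finally show ?case
    by (simp add: Suc.IH scale_right_diff_distrib fdiff_def[of "(fdiff ^^ l) _"]
        funpow_fdiff_shift[of l "\<lambda>i. m (Suc i)"])
qed (simp add: Delta_def)

text \<open>The condition for k = 0 is void because I_0 is the whole algebra, and N entries have
  differences up to order N - 1.\<close>

lemma filt_iff_Delta:
  "filt N 0 (\<lambda>i. m (Suc i)) \<longleftrightarrow> (\<forall>k\<in>{1..N - 1}. Delta scale k m \<in> I k)"
proof -
  have "Delta scale k m \<in> I k \<longleftrightarrow> (fdiff ^^ k) (\<lambda>i. m (Suc i)) 0 \<in> I k" for k
    using ideal_I_scale[of "Delta scale k m" k "(- 1) ^ k"]
      ideal_I_scale[of "(fdiff ^^ k) (\<lambda>i. m (Suc i)) 0" k "(- 1) ^ k"]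
    by (auto simp: Delta_eq_fdiff power_mult_distrib[symmetric])
  then have "filt N 0 (\<lambda>i. m (Suc i)) \<longleftrightarrow> (\<forall>k<N. Delta scale k m \<in> I k)"
    by (simp add: filt_iff_initial)
  also have "\<dots> \<longleftrightarrow> (\<forall>k\<in>{1..N - 1}. Delta scale k m \<in> I k)"
  proof safe
    fix k assume D: "\<forall>k\<in>{1..N - 1}. Delta scale k m \<in> I k" and "k < N"
    then show "Delta scale k m \<in> I k" by (cases k) auto
  qed auto
  finally show ?thesis .
qed

end

section \<open>Band matrices over the algebra\<close>

lemma index_mult_mat_sum:
  fixes X Y :: "'a::semiring_0 mat"
  assumes "X \<in> carrier_mat n n" "Y \<in> carrier_mat n n" "i < n" "j < n"
  shows "(X * Y) $$ (i, j) = (\<Sum>s<n. X $$ (i, s) * Y $$ (s, j))"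
  using assms by (auto simp: scalar_prod_def lessThan_atLeast0 intro!: sum.cong)

text \<open>A value \<open>t\<close> outside the index range expresses that row \<open>i\<close> of
  \<open>X\<close> vanishes, as happens at the border of a band matrix.\<close>

lemma index_mult_mat_single:
  fixes X Y :: "'a::semiring_0 mat"
  assumes "X \<in> carrier_mat n n" "Y \<in> carrier_mat n n" "i < n" "j < n"
    and "\<And>s. s < n \<Longrightarrow> s \<noteq> t \<Longrightarrow> X $$ (i, s) = 0"
  shows "(X * Y) $$ (i, j) = (if t < n then X $$ (i, t) * Y $$ (t, j) else 0)"
proof -
  have "(X * Y) $$ (i, j) = (\<Sum>s<n. if t = s then X $$ (i, s) * Y $$ (s, j) else 0)"
    unfolding index_mult_mat_sum[OF assms(1-4)] using assms(5) by (intro sum.cong) auto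
  then show ?thesis by simp
qed

context k_algebra
begin

(* Both bands are indexed by the column, and the weights are those of E and F: thus
   tensor_mat scale b (sl2_E n) is supm n of the constant sequence b, and likewise for F. *)
definition supm :: "nat \<Rightarrow> (nat \<Rightarrow> 'f) \<Rightarrow> 'f mat" where
  "supm n m = mat n n (\<lambda>(i, j). if j = Suc i then scale (of_nat j) (m j) else 0)"

definition subm :: "nat \<Rightarrow> (nat \<Rightarrow> 'f) \<Rightarrow> 'f mat" where
  "subm n m = mat n n (\<lambda>(i, j). if i = Suc j then scale (of_nat n - of_nat i) (m j) else 0)"

lemma carrier_band [simp]:
  "supm n m \<in> carrier_mat n n" "subm n m \<in> carrier_mat n n" "mat_diag n d \<in> carrier_mat n n"
  "dim_row (supm n m) = n" "dim_col (supm n m) = n"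
  "dim_row (subm n m) = n" "dim_col (subm n m) = n"
  "dim_row (mat_diag n d) = n" "dim_col (mat_diag n d) = n"
  by (auto simp: supm_def subm_def mat_diag_def)

lemma index_band [simp]:
  assumes "i < n" "j < n"
  shows "supm n m $$ (i, j) = (if j = Suc i then scale (of_nat j) (m j) else 0)"
    and "subm n m $$ (i, j) = (if i = Suc j then scale (of_nat n - of_nat i) (m j) else 0)"
    and "mat_diag n d $$ (i, j) = (if i = j then d j else 0)"
  using assms by (auto simp: supm_def subm_def mat_diag_def)

lemma index_band_mult:
  assumes "Y \<in> carrier_mat n n" "i < n" "j < n"
  shows "(supm n m * Y) $$ (i, j)
      = (if Suc i < n then scale (of_nat (Suc i)) (m (Suc i)) * Y $$ (Suc i, j) else 0)"
    and "(subm n m * Y) $$ (i, j)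
      = (if 0 < i then scale (of_nat n - of_nat i) (m (i - 1)) * Y $$ (i - 1, j) else 0)"
    and "(mat_diag n d * Y) $$ (i, j) = d i * Y $$ (i, j)"
proof -
  show "(supm n m * Y) $$ (i, j)
      = (if Suc i < n then scale (of_nat (Suc i)) (m (Suc i)) * Y $$ (Suc i, j) else 0)"
    using assms by (subst index_mult_mat_single[where t = "Suc i" and n = n]) auto
  show "(subm n m * Y) $$ (i, j)
      = (if 0 < i then scale (of_nat n - of_nat i) (m (i - 1)) * Y $$ (i - 1, j) else 0)"
    using assms by (subst index_mult_mat_single[where t = "if i = 0 then n else i - 1" and n = n]) auto
  show "(mat_diag n d * Y) $$ (i, j) = d i * Y $$ (i, j)"
    using assms by (subst index_mult_mat_single[where t = i and n = n]) auto
qed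

lemma supm_eqI: "(\<And>j. 0 < j \<Longrightarrow> j < n \<Longrightarrow> m j = m' j) \<Longrightarrow> supm n m = supm n m'"
  by (rule eq_matI) auto

lemma subm_eqI: "(\<And>j. Suc j < n \<Longrightarrow> m j = m' j) \<Longrightarrow> subm n m = subm n m'"
  by (rule eq_matI) auto

lemma supm_comm_diag:
  "supm n m * mat_diag n d - mat_diag n d * supm n m = supm n (\<lambda>j. m j * d j - d (j - 1) * m j)"
  by (rule eq_matI)
    (auto simp: index_band_mult simp del: index_mult_mat(1) simp: scale_mult scale_right_diff_distrib)

lemma diag_comm_subm:
  "mat_diag n d * subm n m - subm n m * mat_diag n d = subm n (\<lambda>j. d (Suc j) * m j - m j * d j)"
  by (rule eq_matI)
    (auto simp: index_band_mult simp del: index_mult_mat(1) simp: scale_mult scale_right_diff_distrib)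

text \<open>The weights j (n - j) vanish for j = 0 and j = n, so one formula covers the border rows,
  where the indices leave the bands.\<close>

lemma supm_comm_subm:
  "supm n u * subm n v - subm n v * supm n u = mat_diag n (\<lambda>i.
     scale (of_nat (Suc i) * (of_nat n - of_nat (Suc i))) (u (Suc i) * v i)
     - scale (of_nat i * (of_nat n - of_nat i)) (v (i - 1) * u i))"
proof (rule eq_matI, goal_cases)
  case (1 i j)
  then have ij: "i < n" "j < n" by auto
  show ?case
  proof (cases "Suc i < n")
    case True
    then show ?thesis using ij
      by (cases i) (auto simp: index_band_mult scale_mult ac_simps simp del: index_mult_mat(1))
  next
    case False
    then have "n = Suc i" using ij by simp
    then show ?thesis using ij
      by (cases i) (auto simp: index_band_mult scale_mult ac_simps simp del: index_mult_mat(1))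
  qed
qed auto

lemma supm_add: "supm n m + supm n m' = supm n (\<lambda>j. m j + m' j)"
  and subm_add: "subm n m + subm n m' = subm n (\<lambda>j. m j + m' j)"
  by (auto intro!: eq_matI simp: scale_right_distrib)

lemma supm_scale: "map_mat (scale c) (supm n m) = supm n (\<lambda>j. scale c (m j))"
  and subm_scale: "map_mat (scale c) (subm n m) = subm n (\<lambda>j. scale c (m j))"
  by (auto intro!: eq_matI simp: mult.commute)

lemma zero_mat_band: "0\<^sub>m n n = supm n (\<lambda>j. 0)" "0\<^sub>m n n = subm n (\<lambda>j. 0)"
  by (auto intro!: eq_matI)

definition hwt :: "nat \<Rightarrow> nat \<Rightarrow> 'k" where
  "hwt n i = of_nat n - 1 - 2 * of_nat i"

lemma tensor_sl2:
  "tensor_mat scale b (sl2_E n) = supm n (\<lambda>j. b)"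
  "tensor_mat scale b (sl2_F n) = subm n (\<lambda>j. b)"
  "tensor_mat scale b (sl2_H n) = mat_diag n (\<lambda>j. scale (hwt n j) b)"
  by (auto intro!: eq_matI simp: tensor_mat_def sl2_E_def sl2_F_def sl2_H_def hwt_def algebra_simps)

abbreviation "L n \<equiv> lie_alg scale n (sl2_mats n)"

lemma sl2_gens: "sl2_E n \<in> sl2_mats n" "sl2_F n \<in> sl2_mats n" "sl2_H n \<in> sl2_mats n"
  by (auto simp: sl2_mats_def intro: mat_span.base)

lemma tensor_mem_lie_alg: "X \<in> sl2_mats n \<Longrightarrow> tensor_mat scale b X \<in> L n"
  unfolding lie_alg_def tensor_space_def
  by (intro lie_generated.base mat_span.base) blast

lemma gens_mem:
  "supm n (\<lambda>j. b) \<in> L n" "subm n (\<lambda>j. b) \<in> L n" "mat_diag n (\<lambda>j. scale (hwt n j) b) \<in> L n"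
  using tensor_mem_lie_alg[OF sl2_gens(1)] tensor_mem_lie_alg[OF sl2_gens(2)]
    tensor_mem_lie_alg[OF sl2_gens(3)] by (simp_all add: tensor_sl2)

lemma mat_span_carrier: "X \<in> mat_span sc n S \<Longrightarrow> S \<subseteq> carrier_mat n n \<Longrightarrow> X \<in> carrier_mat n n"
  by (induction rule: mat_span.induct) auto

lemma sl2_mats_carrier: "X \<in> sl2_mats n \<Longrightarrow> X \<in> carrier_mat n n"
  unfolding sl2_mats_def
  by (erule mat_span_carrier) (auto simp: sl2_E_def sl2_F_def sl2_H_def)

lemma tensor_space_carrier: "X \<in> tensor_space scale n (sl2_mats n) \<Longrightarrow> X \<in> carrier_mat n n"
  unfolding tensor_space_def
  by (erule mat_span_carrier) (auto simp: tensor_mat_def dest: sl2_mats_carrier)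

lemma lie_alg_carrier: "X \<in> L n \<Longrightarrow> X \<in> carrier_mat n n"
  unfolding lie_alg_def
  by (induction rule: lie_generated.induct) (auto dest: tensor_space_carrier)

lemma lie_alg_closed:
  "0\<^sub>m n n \<in> L n"
  "X \<in> L n \<Longrightarrow> Y \<in> L n \<Longrightarrow> X + Y \<in> L n"
  "X \<in> L n \<Longrightarrow> map_mat (scale c) X \<in> L n"
  "X \<in> L n \<Longrightarrow> Y \<in> L n \<Longrightarrow> X * Y - Y * X \<in> L n"
  by (auto simp: lie_alg_def intro: lie_generated.intros)

end

section \<open>A lower bound for the Lie algebra\<close>

context k_algebra
begin

lemma lie_alg_diff: "X \<in> L n \<Longrightarrow> Y \<in> L n \<Longrightarrow> X - Y \<in> L n"
proof -
  assume X: "X \<in> L n" and Y: "Y \<in> L n"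
  have "X - Y = X + map_mat (scale (- 1)) Y"
    using lie_alg_carrier[OF X] lie_alg_carrier[OF Y] by (intro eq_matI) auto
  then show ?thesis using X Y lie_alg_closed by metis
qed

definition sup_in :: "nat \<Rightarrow> 'f \<Rightarrow> (nat \<Rightarrow> 'k) set" where
  "sup_in n c = {g. supm n (\<lambda>j. scale (g j) c) \<in> L n}"

definition sub_in :: "nat \<Rightarrow> 'f \<Rightarrow> (nat \<Rightarrow> 'k) set" where
  "sub_in n c = {g. subm n (\<lambda>j. scale (g j) c) \<in> L n}"

lemma sup_in_closed:
  "g \<in> sup_in n c \<Longrightarrow> h \<in> sup_in n c \<Longrightarrow> (\<lambda>i. g i + h i) \<in> sup_in n c"
  "g \<in> sup_in n c \<Longrightarrow> (\<lambda>i. a * g i) \<in> sup_in n c"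
  "(\<lambda>i. 0) \<in> sup_in n c"
  using lie_alg_closed(2)[of "supm n (\<lambda>j. scale (g j) c)" n "supm n (\<lambda>j. scale (h j) c)"]
    lie_alg_closed(3)[of "supm n (\<lambda>j. scale (g j) c)" n a] lie_alg_closed(1)[of n]
  by (simp_all add: sup_in_def supm_add supm_scale scale_left_distrib zero_mat_band(1))

lemma sub_in_closed:
  "g \<in> sub_in n c \<Longrightarrow> h \<in> sub_in n c \<Longrightarrow> (\<lambda>i. g i + h i) \<in> sub_in n c"
  "g \<in> sub_in n c \<Longrightarrow> (\<lambda>i. a * g i) \<in> sub_in n c"
  "(\<lambda>i. 0) \<in> sub_in n c"
  using lie_alg_closed(2)[of "subm n (\<lambda>j. scale (g j) c)" n "subm n (\<lambda>j. scale (h j) c)"]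
    lie_alg_closed(3)[of "subm n (\<lambda>j. scale (g j) c)" n a] lie_alg_closed(1)[of n]
  by (simp_all add: sub_in_def subm_add subm_scale scale_left_distrib zero_mat_band(2))

text \<open>\<open>ldc d g 0\<close> means degree below \<open>d\<close>, so
  \<open>full n (Suc k) c\<close> is the claim for degree at most k.\<close>

definition full :: "nat \<Rightarrow> nat \<Rightarrow> 'f \<Rightarrow> bool" where
  "full n d c \<longleftrightarrow> (\<forall>g. ldc d g 0 \<longrightarrow> g \<in> sup_in n c)"

lemma subspace_full: "subspace {c. full n d c}"
proof (rule subspaceI)
  show "0 \<in> {c. full n d c}"
    using lie_alg_closed(1)[of n] by (simp add: full_def sup_in_def zero_mat_band(1))
next
  fix x y assume "x \<in> {c. full n d c}" "y \<in> {c. full n d c}"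
  then show "x + y \<in> {c. full n d c}"
    using lie_alg_closed(2)[of "supm n (\<lambda>j. scale (_ j) x)" n "supm n (\<lambda>j. scale (_ j) y)"]
    by (simp add: full_def sup_in_def supm_add scale_right_distrib)
next
  fix a x assume "x \<in> {c. full n d c}"
  then show "scale a x \<in> {c. full n d c}"
    using lie_alg_closed(3)[of "supm n (\<lambda>j. scale (_ j) x)" n a]
    by (simp add: full_def sup_in_def supm_scale mult.commute)
qed

lemma full_Suc:
  assumes "full n d c" "ldc d g e" "e \<noteq> 0" "g \<in> sup_in n c"
  shows "full n (Suc d) c"
  unfolding full_def
proof safe
  fix h :: "nat \<Rightarrow> 'k" assume "ldc (Suc d) h 0"
  then obtain b where b: "ldc d h b" using ldc_Suc_ex by blast
  have "ldc d (\<lambda>i. h i + (- b / e) * g i) (b + (- b / e) * e)"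
    by (intro ldc_add ldc_cmult assms b)
  then have "(\<lambda>i. h i + (- b / e) * g i) \<in> sup_in n c"
    using assms(1,3) by (simp add: full_def)
  from sup_in_closed(1)[OF this sup_in_closed(2)[OF assms(4), of "b / e"]]
  show "h \<in> sup_in n c" by simp
qed

lemma ldc_hwt: "ldc d g e \<Longrightarrow> ldc (Suc d) (\<lambda>j. hwt n j * g j) (- 2 * of_nat (Suc d) * e)"
  using ldc_mult_linear[of d g e "of_nat n - 1" "- 2"] by (simp add: hwt_def algebra_simps)

(* [c g E, b H] = [c, b] H g E - 2 b c g E *)
lemma bracket_H:
  assumes "g \<in> sup_in n c"
  shows "supm n (\<lambda>j. scale (hwt n j * g j) (c * b - b * c) + scale (- 2 * g j) (b * c)) \<in> L n"
proof -
  let ?X = "supm n (\<lambda>j. scale (g j) c)" and ?Y = "mat_diag n (\<lambda>j. scale (hwt n j) b)"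
  have "?X * ?Y - ?Y * ?X \<in> L n"
    using assms gens_mem by (intro lie_alg_closed) (auto simp: sup_in_def)
  moreover have "?X * ?Y - ?Y * ?X
      = supm n (\<lambda>j. scale (hwt n j * g j) (c * b - b * c) + scale (- 2 * g j) (b * c))"
    unfolding supm_comm_diag
  proof (rule supm_eqI)
    fix j :: nat assume "0 < j"
    then have "hwt n (j - 1) = hwt n j + 2" by (cases j) (auto simp: hwt_def)
    then show "scale (g j) c * scale (hwt n j) b - scale (hwt n (j - 1)) b * scale (g j) c
      = scale (hwt n j * g j) (c * b - b * c) + scale (- 2 * g j) (b * c)"
      by (simp add: scale_mult scale_left_distrib scale_right_diff_distrib algebra_simps)
  qed
  ultimately show ?thesis by simp
qed

text \<open>The diagonal of [g E, F], in which j (n - j) is the product of the weights of E and F at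
  column j. For g = 1 it is the weight function \<open>hwt n\<close>.\<close>

definition raise_diag :: "nat \<Rightarrow> (nat \<Rightarrow> 'k) \<Rightarrow> nat \<Rightarrow> 'k" where
  "raise_diag n g = fdiff (\<lambda>j. of_nat j * (of_nat n - of_nat j) * g j)"

text \<open>Two linear factors of slopes 1 and -1 multiply the value by - (d + 1) (d + 2); the outer
  difference lowers the degree by one and keeps the value.\<close>

lemma ldc_raise_diag:
  assumes "ldc d g e"
  shows "ldc (Suc d) (raise_diag n g) (- (of_nat (Suc d) * of_nat (Suc (Suc d)) * e))"
proof -
  have "ldc (Suc (Suc d)) (\<lambda>j. (0 + 1 * of_nat j) * ((of_nat n + (- 1) * of_nat j) * g j))
      (of_nat (Suc (Suc d)) * 1 * (of_nat (Suc d) * (- 1) * e))"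
    by (intro ldc_mult_linear assms)
  then show ?thesis by (simp add: raise_diag_def algebra_simps)
qed

lemma diag_mem:
  assumes "g \<in> sup_in n c"
  shows "mat_diag n (\<lambda>j. scale (raise_diag n g j) c) \<in> L n"
proof -
  let ?X = "supm n (\<lambda>j. scale (g j) c)" and ?Y = "subm n (\<lambda>j. 1)"
  have "?X * ?Y - ?Y * ?X \<in> L n"
    using assms gens_mem by (intro lie_alg_closed) (auto simp: sup_in_def)
  moreover have "?X * ?Y - ?Y * ?X = mat_diag n (\<lambda>j. scale (raise_diag n g j) c)"
    unfolding supm_comm_subm
    by (rule arg_cong[where f = "mat_diag n"])
      (simp add: fun_eq_iff raise_diag_def fdiff_def scale_left_diff_distrib)
  ultimately show ?thesis by simp
qed

(* [b E, c P] with P the diagonal produced by diag_mem; P0 is P shifted by one. *)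
lemma bracket_diag:
  assumes "g \<in> sup_in n c" "\<And>i. P0 (Suc i) = raise_diag n g i"
  shows "supm n (\<lambda>j. scale (- P0 j) (c * b - b * c) + scale (fdiff P0 j) (b * c)) \<in> L n"
proof -
  let ?X = "supm n (\<lambda>j. b)" and ?Y = "mat_diag n (\<lambda>j. scale (raise_diag n g j) c)"
  have "?X * ?Y - ?Y * ?X \<in> L n"
    using assms gens_mem diag_mem by (intro lie_alg_closed) auto
  moreover have "?X * ?Y - ?Y * ?X
      = supm n (\<lambda>j. scale (- P0 j) (c * b - b * c) + scale (fdiff P0 j) (b * c))"
    unfolding supm_comm_diag
  proof (rule supm_eqI)
    fix j :: nat assume "0 < j"
    then show "b * scale (raise_diag n g j) c - scale (raise_diag n g (j - 1)) c * b
      = scale (- P0 j) (c * b - b * c) + scale (fdiff P0 j) (b * c)"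
      using assms(2)[of "j - 1"] assms(2)[of j]
      by (simp add: scale_mult fdiff_def scale_left_diff_distrib scale_right_diff_distrib)
  qed
  ultimately show ?thesis by simp
qed

text \<open>In \<open>bracket_H\<close> with g of degree k, the term - 2 b c g E already lies in L.
  What remains is [c, b] H g E, whose polynomial has exact degree k + 1.\<close>

lemma full_comm:
  assumes "full n (Suc k) c" "full n (Suc k) (b * c)" "full n (Suc k) (c * b - b * c)"
  shows "full n (Suc (Suc k)) (c * b - b * c)"
proof -
  let ?g = "\<lambda>i. of_nat (i choose k) :: 'k"
  have g: "ldc k ?g 1" by (rule ldc_binomial)
  have g': "ldc (Suc k) ?g 0" by (rule ldc_Suc[OF g])
  have "?g \<in> sup_in n c" using assms(1) g' by (simp add: full_def)
  from bracket_H[OF this, of b]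
  have "supm n (\<lambda>j. scale (hwt n j * ?g j) (c * b - b * c) + scale (- 2 * ?g j) (b * c)) \<in> L n" .
  moreover have "supm n (\<lambda>j. scale (2 * ?g j) (b * c)) \<in> L n"
    using assms(2) ldc_cmult[OF g', of 2] by (simp add: full_def sup_in_def)
  ultimately have "(\<lambda>j. hwt n j * ?g j) \<in> sup_in n (c * b - b * c)"
    using lie_alg_closed(2) by (fastforce simp: sup_in_def supm_add)
  moreover have "- 2 * of_nat (Suc k) * 1 \<noteq> (0 :: 'k)"
    using of_nat_neq_0[of k, where 'a = 'k] by (simp del: of_nat_Suc)
  ultimately show ?thesis
    using full_Suc[OF assms(3) ldc_hwt[OF g]] by blast
qed

(* The combination 2 [b E, c P] + (k + 3) [c g E, b H] of the two brackets above cancels the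
   term of top degree in the coefficient [c, b]. *)
lemma full_mult_left:
  assumes "full n (Suc (Suc k)) c" "full n (Suc k) (b * c)" "full n (Suc (Suc k)) (c * b - b * c)"
  shows "full n (Suc (Suc k)) (b * c)"
proof -
  define m where "m = Suc k"
  define g :: "nat \<Rightarrow> 'k" where "g i = of_nat (i choose m)" for i
  have g: "ldc m g 1" using ldc_binomial[of m] by (simp add: g_def[abs_def])
  have gc: "g \<in> sup_in n c" using assms(1) ldc_Suc[OF g] by (simp add: full_def m_def)
  obtain P0 where P0: "ldc (Suc m) P0 (- (of_nat (Suc m) * of_nat (Suc (Suc m)) * 1))"
    "\<And>i. P0 (Suc i) = raise_diag n g i"
    using ldc_unshift[OF ldc_raise_diag[OF g]] by blast
  let ?s = "of_nat (Suc (Suc m)) :: 'k"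
  \<comment> \<open>The values at order m + 1 of the two summands are 2 (m + 1) (m + 2) and - 2 (m +
    1) (m + 2), so \<open>Q\<close> has degree at most m.\<close>
  define Q where "Q j = - 2 * P0 j + ?s * (hwt n j * g j)" for j
  have "ldc (Suc m) Q (- 2 * (- (of_nat (Suc m) * of_nat (Suc (Suc m)) * 1))
      + ?s * (- 2 * of_nat (Suc m) * 1))"
    unfolding Q_def[abs_def] by (intro ldc_add ldc_cmult P0 ldc_hwt g)
  then have "ldc (Suc m) Q 0" by (simp add: algebra_simps)
  then have Q: "Q \<in> sup_in n (c * b - b * c)" using assms(3) by (simp add: full_def m_def)
  \<comment> \<open>The cofactor of b c: its value at order m is - 2 (m + 1) (m + 2) - 2 (m + 2) = -
    2 (m + 2)^2, nonzero in characteristic 0.\<close>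
  define R where "R j = 2 * fdiff P0 j + (- 2 * ?s) * g j" for j
  have "ldc m R (2 * (- (of_nat (Suc m) * of_nat (Suc (Suc m)) * 1)) + (- 2 * ?s) * 1)"
    unfolding R_def[abs_def] using P0(1) by (intro ldc_add ldc_cmult g) auto
  then have R: "ldc m R (- 2 * ?s * ?s)" by (simp add: algebra_simps)
  have "map_mat (scale 2) (supm n (\<lambda>j. scale (- P0 j) (c * b - b * c) + scale (fdiff P0 j) (b * c)))
      + map_mat (scale ?s)
        (supm n (\<lambda>j. scale (hwt n j * g j) (c * b - b * c) + scale (- 2 * g j) (b * c))) \<in> L n"
    by (intro lie_alg_closed bracket_diag[OF gc P0(2)] bracket_H[OF gc])
  then have "supm n (\<lambda>j. scale (Q j) (c * b - b * c) + scale (R j) (b * c)) \<in> L n"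
    by (simp add: supm_scale supm_add Q_def R_def scale_right_distrib scale_left_distrib
        scale_left_diff_distrib algebra_simps)
  from lie_alg_diff[OF this Q[unfolded sup_in_def mem_Collect_eq]]
  have "supm n (\<lambda>j. scale (Q j) (c * b - b * c) + scale (R j) (b * c))
      - supm n (\<lambda>j. scale (Q j) (c * b - b * c)) \<in> L n" .
  also have "supm n (\<lambda>j. scale (Q j) (c * b - b * c) + scale (R j) (b * c))
      - supm n (\<lambda>j. scale (Q j) (c * b - b * c)) = supm n (\<lambda>j. scale (R j) (b * c))"
    by (rule eq_matI) (auto simp: scale_right_distrib)
  finally have "R \<in> sup_in n (b * c)" by (simp add: sup_in_def)
  moreover have "- 2 * ?s * ?s \<noteq> 0"
    using of_nat_neq_0[of "Suc m", where 'a = 'k] by (simp del: of_nat_Suc)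
  ultimately have "full n (Suc m) (b * c)"
    using full_Suc[OF _ R] assms(2) by (simp add: m_def)
  then show ?thesis by (simp add: m_def)
qed

lemma full_ideal_I: "c \<in> I k \<Longrightarrow> full n (Suc k) c"
proof (induction k arbitrary: c)
  case 0
  show ?case unfolding full_def
  proof safe
    fix g :: "nat \<Rightarrow> 'k" assume "ldc (Suc 0) g 0"
    then obtain a where "g = (\<lambda>i. a)" using ldc_Suc_ex by fastforce
    then show "g \<in> sup_in n c" using gens_mem(1) by (simp add: sup_in_def)
  qed
next
  case (Suc k)
  have comm: "full n (Suc (Suc k)) (c * x - x * c)" if "c \<in> I k" for c x
    using that by (intro full_comm Suc.IH ideal_I_mult_left ideal_I_diff ideal_I_mult_right)
  \<comment> \<open>\<open>full_mult_left\<close> is used with the commutator [c, x] in place of c.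
    This lies in I_k as well, so its commutator with b is again covered by
    \<open>comm\<close>.\<close>
  have "full n (Suc (Suc k)) (b * (c * x - x * c))" if "c \<in> I k" for b c x
  proof -
    have "c * x - x * c \<in> I k"
      using that by (intro ideal_I_mult_left ideal_I_diff ideal_I_mult_right)
    then show ?thesis
      by (intro full_mult_left comm that Suc.IH ideal_I_mult_left)
  qed
  then have "{b * (c * x - x * c) |b c x. c \<in> I k} \<subseteq> {c. full n (Suc (Suc k)) c}" by blast
  from span_minimal[OF this subspace_full] ideal_I_Suc_le_comm_ideal[OF Suc.prems]
  show ?case by (auto simp: comm_ideal_def)
qed

text \<open>The F-band is derived from the E-band: bracketing the diagonals of
  \<open>diag_mem\<close> with F gives a function of each exact degree up to k.\<close>

lemma sub_in_ideal_I:
  assumes c: "c \<in> I k" and h: "ldc (Suc k) h 0"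
  shows "h \<in> sub_in n c"
proof (rule ldc_fill[OF _ _ _ _ h])
  fix d assume d: "d < Suc k"
  define g :: "nat \<Rightarrow> 'k" where "g i = of_nat (i choose d)" for i
  have g: "ldc d g 1" using ldc_binomial[of d] by (simp add: g_def[abs_def])
  have gc: "g \<in> sup_in n c"
    using full_ideal_I[OF c] ldc_mono[OF Suc_leI[OF d] ldc_Suc[OF g]] by (simp add: full_def)
  let ?X = "mat_diag n (\<lambda>j. scale (raise_diag n g j) c)" and ?Y = "subm n (\<lambda>j. 1)"
  have "?X * ?Y - ?Y * ?X \<in> L n"
    by (intro lie_alg_closed diag_mem[OF gc] gens_mem)
  then have "fdiff (raise_diag n g) \<in> sub_in n c"
    by (simp add: diag_comm_subm sub_in_def fdiff_def scale_left_diff_distrib)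
  moreover have "ldc d (fdiff (raise_diag n g)) (- (of_nat (Suc d) * of_nat (Suc (Suc d)) * 1))"
    using ldc_raise_diag[OF g] by simp
  moreover have "- (of_nat (Suc d) * of_nat (Suc (Suc d)) * 1) \<noteq> (0 :: 'k)"
    using of_nat_neq_0[of d, where 'a = 'k] of_nat_neq_0[of "Suc d", where 'a = 'k]
    by (simp del: of_nat_Suc)
  ultimately show "\<exists>g\<in>sub_in n c. \<exists>e. e \<noteq> 0 \<and> ldc d g e" by blast
qed (use sub_in_closed in auto)

lemma supm_sum_mem:
  assumes "\<And>k. k \<in> A \<Longrightarrow> supm n (u k) \<in> L n" "finite A"
  shows "supm n (\<lambda>j. \<Sum>k\<in>A. u k j) \<in> L n"
  using assms(2,1)
  by (induction A rule: finite_induct)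
    (auto simp: zero_mat_band(1)[symmetric] supm_add[symmetric] intro: lie_alg_closed)

lemma subm_sum_mem:
  assumes "\<And>k. k \<in> A \<Longrightarrow> subm n (u k) \<in> L n" "finite A"
  shows "subm n (\<lambda>j. \<Sum>k\<in>A. u k j) \<in> L n"
  using assms(2,1)
  by (induction A rule: finite_induct)
    (auto simp: zero_mat_band(2)[symmetric] subm_add[symmetric] intro: lie_alg_closed)

lemma newton_forward_le:
  assumes "i < N"
  shows "m i = (\<Sum>k<N. scale (of_nat (i choose k)) ((fdiff ^^ k) m 0))"
  unfolding newton_forward[of m i]
  using assms by (intro sum.mono_neutral_left) auto

lemma supm_mem:
  assumes "filt (n - 1) 0 (\<lambda>i. m (Suc i))"
  shows "supm n m \<in> L n"
proof -
  \<comment> \<open>The binomial polynomial of j - 1 in the column j. It has to be extended to j = 0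
    as a polynomial, where truncated subtraction would fail.\<close>
  have "\<exists>g. ldc k g 1 \<and> (\<forall>i. g (Suc i) = (of_nat (i choose k) :: 'k))" for k
    by (rule ldc_unshift[OF ldc_binomial])
  then obtain g where g: "ldc k (g k) 1" "g k (Suc i) = (of_nat (i choose k) :: 'k)" for k i
    by metis
  let ?c = "\<lambda>k. (fdiff ^^ k) (\<lambda>i. m (Suc i)) 0"
  have "supm n m = supm n (\<lambda>j. \<Sum>k<n - 1. scale (g k j) (?c k))"
  proof (rule supm_eqI)
    fix j :: nat assume "0 < j" "j < n"
    then obtain i where i: "j = Suc i" "i < n - 1" by (cases j) auto
    show "m j = (\<Sum>k<n - 1. scale (g k j) (?c k))"
      using newton_forward_le[OF i(2), of "\<lambda>i. m (Suc i)"] by (simp add: i g)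
  qed
  also have "\<dots> \<in> L n"
  proof (rule supm_sum_mem)
    fix k assume "k \<in> {..<n - 1}"
    then have "?c k \<in> I k" using assms by (simp add: filt_iff_initial)
    from full_ideal_I[OF this] show "supm n (\<lambda>j. scale (g k j) (?c k)) \<in> L n"
      using ldc_Suc[OF g(1)] by (simp add: full_def sup_in_def)
  qed simp
  finally show ?thesis .
qed

lemma subm_mem:
  assumes "filt (n - 1) 0 m"
  shows "subm n m \<in> L n"
proof -
  let ?c = "\<lambda>k. (fdiff ^^ k) m 0"
  have "subm n m = subm n (\<lambda>j. \<Sum>k<n - 1. scale (of_nat (j choose k)) (?c k))"
    by (rule subm_eqI, rule newton_forward_le) simp
  also have "\<dots> \<in> L n"
  proof (rule subm_sum_mem)
    fix k assume "k \<in> {..<n - 1}"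
    then have "?c k \<in> I k" using assms by (simp add: filt_iff_initial)
    from sub_in_ideal_I[OF this ldc_Suc[OF ldc_binomial]]
    show "subm n (\<lambda>j. scale (of_nat (j choose k)) (?c k)) \<in> L n"
      by (simp add: sub_in_def)
  qed simp
  finally show ?thesis .
qed

end

section \<open>The filtration of $M_n(k)$ by products of elements of $sl_2$\<close>

lemma ldc_zero: "ldc d (\<lambda>i. 0) 0"
  by (induction d) (simp_all add: fdiff_def[abs_def])

lemma ldc_mult_linear_0: "ldc d g 0 \<Longrightarrow> ldc (Suc d) (\<lambda>i. (a + b * of_nat i) * g i) 0"
  using ldc_mult_linear[of d g 0 a b] by simp

text \<open>For d > j both truncated differences are 0, and \<open>ldc 0 q 0\<close> forces q = 0:
  such a band is empty and stays so.\<close>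

lemma ldc_mult_linear_trunc:
  assumes "ldc (j - d) q 0"
  shows "ldc (Suc j - d) (\<lambda>i. (a + b * of_nat i) * q i) 0"
proof (cases "d \<le> j")
  case True
  then show ?thesis using ldc_mult_linear_0[OF assms] by (simp add: Suc_diff_le)
next
  case False
  then show ?thesis using assms by (simp add: ldc_zero)
qed

text \<open>The levels A_j. Left multiplication by a generator is the only product rule, so that
  inductions peel off one generator at a time.\<close>

inductive sl2_filt :: "nat \<Rightarrow> nat \<Rightarrow> 'k::field_char_0 mat \<Rightarrow> bool" for n where
  one: "sl2_filt n j (1\<^sub>m n)"
| add: "sl2_filt n j X \<Longrightarrow> sl2_filt n j Y \<Longrightarrow> sl2_filt n j (X + Y)"
| smult: "sl2_filt n j X \<Longrightarrow> sl2_filt n j (c \<cdot>\<^sub>m X)"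
| mult: "G \<in> {sl2_E n, sl2_F n, sl2_H n} \<Longrightarrow> sl2_filt n j X \<Longrightarrow> sl2_filt n (Suc j) (G * X)"

lemma sl2_carrier [simp]:
  "sl2_E n \<in> carrier_mat n n" "sl2_F n \<in> carrier_mat n n" "sl2_H n \<in> carrier_mat n n"
  by (auto simp: sl2_E_def sl2_F_def sl2_H_def)

lemma sl2_gen_carrier: "G \<in> {sl2_E n, sl2_F n, sl2_H n} \<Longrightarrow> G \<in> carrier_mat n n"
  by auto

lemma sl2_filt_carrier: "sl2_filt n j X \<Longrightarrow> X \<in> carrier_mat n n"
  by (induction rule: sl2_filt.induct) (auto intro!: mult_carrier_mat[of _ n n _ n])

lemma sl2_filt_zero: "sl2_filt n j (0\<^sub>m n n :: 'a::field_char_0 mat)"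
proof -
  have "0 \<cdot>\<^sub>m 1\<^sub>m n = (0\<^sub>m n n :: 'a mat)" by (rule eq_matI) auto
  then show ?thesis using sl2_filt.smult[OF sl2_filt.one, of n j 0] by metis
qed

lemma sl2_filt_Suc: "sl2_filt n j X \<Longrightarrow> sl2_filt n (Suc j) X"
  by (induction rule: sl2_filt.induct) (auto intro: sl2_filt.intros)

lemma sl2_filt_uminus_diff: "sl2_filt n j (X - Y) \<Longrightarrow> X \<in> carrier_mat n n \<Longrightarrow> Y \<in> carrier_mat n n
  \<Longrightarrow> sl2_filt n j (Y - X)"
proof -
  assume X: "X \<in> carrier_mat n n" "Y \<in> carrier_mat n n" and f: "sl2_filt n j (X - Y)"
  have "(- 1) \<cdot>\<^sub>m (X - Y) = Y - X" using X by (intro eq_matI) auto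
  then show ?thesis using sl2_filt.smult[OF f, of "- 1"] by simp
qed

lemma sl2_filt_mult:
  assumes "sl2_filt n a X" and Y: "sl2_filt n b Y"
  shows "sl2_filt n (a + b) (X * Y)"
  using assms(1)
proof (induction rule: sl2_filt.induct)
  case (one j)
  then show ?case using sl2_filt_carrier[OF Y] Y by (induction j) (auto intro: sl2_filt_Suc)
next
  case (add j X X')
  then show ?case
    unfolding add_mult_distrib_mat[OF add.hyps(1,2)[THEN sl2_filt_carrier] sl2_filt_carrier[OF Y]]
    by (intro sl2_filt.add)
next
  case (smult j X c)
  then show ?case
    unfolding mult_smult_assoc_mat[OF sl2_filt_carrier[OF smult.hyps] sl2_filt_carrier[OF Y]]
    by (intro sl2_filt.smult)
next
  case (mult G j X)
  then show ?case
    unfolding assoc_mult_mat[OF sl2_gen_carrier[OF mult.hyps(1)] sl2_filt_carrier[OF mult.hyps(2)]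
        sl2_filt_carrier[OF Y]] add_Suc
    by (intro sl2_filt.mult)
qed

lemma mat_comm_leibniz:
  fixes G X Y :: "'a::ring mat"
  assumes "G \<in> carrier_mat n n" "X \<in> carrier_mat n n" "Y \<in> carrier_mat n n"
  shows "(G * X) * Y - Y * (G * X) = G * (X * Y - Y * X) + (G * Y - Y * G) * X"
proof -
  have "G * (X * Y - Y * X) = G * (X * Y) - G * (Y * X)"
    using assms by (intro mult_minus_distrib_mat[of _ n n _ n]) auto
  moreover have "(G * Y - Y * G) * X = G * (Y * X) - Y * (G * X)"
    using assms minus_mult_distrib_mat[of "G * Y" n n "Y * G" X n]
    by (simp add: assoc_mult_mat[of _ n n _ n _ n] mult_carrier_mat[of _ n n])
  moreover have "(G * X) * Y = G * (X * Y)"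
    using assms by (rule assoc_mult_mat)
  ultimately show ?thesis
    using assms by (intro eq_matI) auto
qed

lemma mat_comm_add_left:
  fixes X Y Z :: "'a::ring mat"
  assumes "X \<in> carrier_mat n n" "Y \<in> carrier_mat n n" "Z \<in> carrier_mat n n"
  shows "(X + Y) * Z - Z * (X + Y) = (X * Z - Z * X) + (Y * Z - Z * Y)"
  using add_mult_distrib_mat[OF assms] mult_add_distrib_mat[OF assms(3,1,2)] assms
  by (intro eq_matI) auto

lemma mat_comm_smult_left:
  fixes X Y :: "'a::comm_ring mat"
  assumes "X \<in> carrier_mat n n" "Y \<in> carrier_mat n n"
  shows "(c \<cdot>\<^sub>m X) * Y - Y * (c \<cdot>\<^sub>m X) = c \<cdot>\<^sub>m (X * Y - Y * X)"
  unfolding mult_smult_assoc_mat[OF assms] mult_smult_distrib[OF assms(2,1)]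
  using assms by (intro eq_matI) (auto simp: right_diff_distrib)

lemma sl2_comm_gens:
  fixes G G' :: "'k::field_char_0 mat"
  assumes "G \<in> {sl2_E n, sl2_F n, sl2_H n}" "G' \<in> {sl2_E n, sl2_F n, sl2_H n}"
  shows "\<exists>c. \<exists>K\<in>{sl2_E n, sl2_F n, sl2_H n}. G * G' - G' * G = c \<cdot>\<^sub>m K"
proof -
  \<comment> \<open>The scalars as an algebra over themselves: the band commutator formulas then
    yield the sl2 relations.\<close>
  interpret K: k_algebra "(*) :: 'k \<Rightarrow> 'k \<Rightarrow> 'k"
    by unfold_locales (auto simp: algebra_simps)
  have E: "sl2_E n = K.supm n (\<lambda>j. 1)" and F: "sl2_F n = K.subm n (\<lambda>j. 1)"
    and H: "sl2_H n = mat_diag n (K.hwt n)"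
    by (auto intro!: eq_matI simp: sl2_E_def sl2_F_def sl2_H_def K.hwt_def)
  have self: "X * X - X * X = 0 \<cdot>\<^sub>m X" if "X \<in> carrier_mat n n" for X :: "'k mat"
    using that by (intro eq_matI) auto
  have anti: "Y * X - X * Y = (- c) \<cdot>\<^sub>m Z"
    if "X * Y - Y * X = c \<cdot>\<^sub>m Z" "X \<in> carrier_mat n n" "Y \<in> carrier_mat n n" "Z \<in> carrier_mat n n"
    for X Y Z :: "'k mat" and c
  proof -
    have "Y * X - X * Y = (- 1) \<cdot>\<^sub>m (X * Y - Y * X)" using that(2,3) by (intro eq_matI) auto
    then show ?thesis unfolding that(1) using that(4) by (auto intro!: eq_matI)
  qed
  have EF: "sl2_E n * sl2_F n - sl2_F n * sl2_E n = 1 \<cdot>\<^sub>m (sl2_H n :: 'k mat)"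
    unfolding E F H K.supm_comm_subm
    by (rule eq_matI) (auto simp: K.hwt_def algebra_simps)
  have EH: "sl2_E n * sl2_H n - sl2_H n * sl2_E n = (- 2) \<cdot>\<^sub>m (sl2_E n :: 'k mat)"
    unfolding E H K.supm_comm_diag
    by (rule eq_matI) (auto simp: K.hwt_def algebra_simps)
  have HF: "sl2_H n * sl2_F n - sl2_F n * sl2_H n = (- 2) \<cdot>\<^sub>m (sl2_F n :: 'k mat)"
    unfolding F H K.diag_comm_subm
    by (rule eq_matI) (auto simp: K.hwt_def algebra_simps)
  note r = EF EH HF EF[THEN anti] EH[THEN anti] HF[THEN anti] self
  show ?thesis using assms by (auto simp: r simp del: minus_r_inv_mat)
qed

text \<open>Bracketing with a generator is a derivation sending generators to multiples of
  generators, so the number of factors does not grow.\<close>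

lemma sl2_filt_comm_gen:
  assumes "sl2_filt n b X" and G: "G \<in> {sl2_E n, sl2_F n, sl2_H n}"
  shows "sl2_filt n b (X * G - G * X)"
  using assms(1)
proof (induction rule: sl2_filt.induct)
  case (one j)
  have "1\<^sub>m n * G - G * 1\<^sub>m n = 0\<^sub>m n n" using sl2_gen_carrier[OF G] by simp
  then show ?case using sl2_filt_zero by metis
next
  case (add j X Y)
  then show ?case
    unfolding mat_comm_add_left[OF add.hyps(1,2)[THEN sl2_filt_carrier] sl2_gen_carrier[OF G]]
    by (intro sl2_filt.add)
next
  case (smult j X c)
  then show ?case
    unfolding mat_comm_smult_left[OF sl2_filt_carrier[OF smult.hyps] sl2_gen_carrier[OF G]]
    by (intro sl2_filt.smult)
next
  case (mult G' j X)
  note c = sl2_gen_carrier[OF mult.hyps(1)] sl2_filt_carrier[OF mult.hyps(2)] sl2_gen_carrier[OF G]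
  obtain a K where K: "K \<in> {sl2_E n, sl2_F n, sl2_H n}" "G' * G - G * G' = a \<cdot>\<^sub>m K"
    using sl2_comm_gens[OF mult.hyps(1) G] by blast
  show ?case
    unfolding mat_comm_leibniz[OF c] K(2) mult_smult_assoc_mat[OF sl2_gen_carrier[OF K(1)] c(2)]
    by (intro sl2_filt.add sl2_filt.smult sl2_filt.mult mult.hyps mult.IH K)
qed

text \<open>One level below the product, that is, commutative up to lower order. In the Leibniz rule
  the bracket of a generator with \<open>Y\<close> stays at the level of \<open>Y\<close>, so that
  generator is saved. \<open>Suc b\<close> avoids a truncated subtraction.\<close>

lemma sl2_filt_comm:
  assumes "sl2_filt n a X" and Y: "sl2_filt n (Suc b) Y"
  shows "sl2_filt n (a + b) (X * Y - Y * X)"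
  using assms(1)
proof (induction rule: sl2_filt.induct)
  case (one j)
  have "1\<^sub>m n * Y - Y * 1\<^sub>m n = 0\<^sub>m n n" using sl2_filt_carrier[OF Y] by simp
  then show ?case using sl2_filt_zero by metis
next
  case (add j X X')
  then show ?case
    unfolding mat_comm_add_left[OF add.hyps(1,2)[THEN sl2_filt_carrier] sl2_filt_carrier[OF Y]]
    by (intro sl2_filt.add)
next
  case (smult j X c)
  then show ?case
    unfolding mat_comm_smult_left[OF sl2_filt_carrier[OF smult.hyps] sl2_filt_carrier[OF Y]]
    by (intro sl2_filt.smult)
next
  case (mult G j X)
  note c = sl2_gen_carrier[OF mult.hyps(1)] sl2_filt_carrier[OF mult.hyps(2)] sl2_filt_carrier[OF Y]
  have "sl2_filt n (Suc b) (G * Y - Y * G)"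
    by (rule sl2_filt_uminus_diff[OF sl2_filt_comm_gen[OF Y mult.hyps(1)]])
      (intro mult_carrier_mat[of _ n n _ n] c)+
  from sl2_filt_mult[OF this mult.hyps(2)]
  have "sl2_filt n (Suc (j + b)) ((G * Y - Y * G) * X)" by (simp add: add.commute)
  moreover have "sl2_filt n (Suc (j + b)) (G * (X * Y - Y * X))"
    by (intro sl2_filt.mult mult.hyps mult.IH)
  ultimately show ?case
    unfolding mat_comm_leibniz[OF c] add_Suc by (intro sl2_filt.add)
qed

section \<open>Polynomial shape of the diagonals of the matrices in A_j\<close>

definition lowfac :: "nat \<Rightarrow> nat \<Rightarrow> 'k::field_char_0" where
  "lowfac c d = (\<Prod>t<d. of_nat c - of_nat t)"

text \<open>On the monomial x^c, \<open>upfac n c e\<close> is the coefficient of F^e and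
  \<open>lowfac c d\<close> that of E^d.\<close>

definition upfac :: "nat \<Rightarrow> nat \<Rightarrow> nat \<Rightarrow> 'k::field_char_0" where
  "upfac n c e = (\<Prod>t<e. of_nat n - 1 - of_nat c - of_nat t)"

(* In the model x^0, ..., x^(n-1) of the module, E = d/dx and F = (n-1) x - x^2 d/dx, so products
   of at most j generators are differential operators of order at most j; band_form is the shape
   of their matrices, with entries written as functions of the column. *)
definition band_form :: "nat \<Rightarrow> nat \<Rightarrow> 'k::field_char_0 mat \<Rightarrow> bool" where
  "band_form n j X \<longleftrightarrow>
    (\<forall>d. \<exists>q. ldc (Suc j - d) q 0 \<and> (\<forall>r. r + d < n \<longrightarrow> X $$ (r, r + d) = lowfac (r + d) d * q (r + d))) \<and>
    (\<forall>e. \<exists>q. ldc (j - e) q 0 \<and> (\<forall>c. Suc (c + e) < n \<longrightarrow> X $$ (Suc (c + e), c) = upfac n c (Suc e) * q c))"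

lemma band_formI:
  assumes "\<And>d. ldc (Suc j - d) (p d) 0"
    "\<And>d r. r + d < n \<Longrightarrow> X $$ (r, r + d) = lowfac (r + d) d * p d (r + d)"
    "\<And>e. ldc (j - e) (q e) 0"
    "\<And>e c. Suc (c + e) < n \<Longrightarrow> X $$ (Suc (c + e), c) = upfac n c (Suc e) * q e c"
  shows "band_form n j X"
  unfolding band_form_def using assms by blast

lemma band_formE:
  assumes "band_form n j X"
  obtains p q where "\<And>d. ldc (Suc j - d) (p d) 0"
    "\<And>d r. r + d < n \<Longrightarrow> X $$ (r, r + d) = lowfac (r + d) d * p d (r + d)"
    "\<And>e. ldc (j - e) (q e) 0"
    "\<And>e c. Suc (c + e) < n \<Longrightarrow> X $$ (Suc (c + e), c) = upfac n c (Suc e) * q e c"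
  using assms unfolding band_form_def by metis

lemma band_form_H:
  assumes "X \<in> carrier_mat n n" "band_form n j X"
  shows "band_form n (Suc j) (sl2_H n * X)"
proof -
  obtain p q where X: "\<And>d. ldc (Suc j - d) (p d) 0"
    "\<And>d r. r + d < n \<Longrightarrow> X $$ (r, r + d) = lowfac (r + d) d * p d (r + d)"
    "\<And>e. ldc (j - e) (q e) 0"
    "\<And>e c. Suc (c + e) < n \<Longrightarrow> X $$ (Suc (c + e), c) = upfac n c (Suc e) * q e c"
    using band_formE[OF assms(2)] by metis
  have HX: "(sl2_H n * X) $$ (r, c) = (of_nat n - 1 - 2 * of_nat r) * X $$ (r, c)"
    if "r < n" "c < n" for r c
    using that assms(1)
    by (subst index_mult_mat_single[where t = r and n = n]) (auto simp: sl2_H_def)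
  show ?thesis
  proof (rule band_formI)
    fix d
    \<comment> \<open>The eigenvalue n - 1 - 2 r of row r is rewritten in the column c: r = c - d on
      or above the diagonal, r = c + d + 1 below it.\<close>
    show "ldc (Suc (Suc j) - d)
        (\<lambda>c. (of_nat n - 1 + 2 * of_nat d + (- 2) * of_nat c) * p d c) 0"
      by (rule ldc_mult_linear_trunc[OF X(1)])
    show "ldc (Suc j - d)
        (\<lambda>c. (of_nat n - 1 - 2 * of_nat (Suc d) + (- 2) * of_nat c) * q d c) 0"
      by (rule ldc_mult_linear_trunc[OF X(3)])
  qed (auto simp: HX X(2,4))
qed

lemma band_form_E:
  assumes "X \<in> carrier_mat n n" "band_form n j X"
  shows "band_form n (Suc j) (sl2_E n * X)"
proof -
  obtain p q where X: "\<And>d. ldc (Suc j - d) (p d) 0"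
    "\<And>d r. r + d < n \<Longrightarrow> X $$ (r, r + d) = lowfac (r + d) d * p d (r + d)"
    "\<And>e. ldc (j - e) (q e) 0"
    "\<And>e c. Suc (c + e) < n \<Longrightarrow> X $$ (Suc (c + e), c) = upfac n c (Suc e) * q e c"
    using band_formE[OF assms(2)] by metis
  have EX: "(sl2_E n * X) $$ (r, c) = (if Suc r < n then of_nat (Suc r) * X $$ (Suc r, c) else 0)"
    if "r < n" "c < n" for r c
    using that assms(1)
    by (subst index_mult_mat_single[where t = "Suc r" and n = n]) (auto simp: sl2_E_def)
  \<comment> \<open>E moves a lower band one step up, which needs one factor of \<open>upfac\<close>
    less. The surplus factor n - (e + 1) - c and the row weight c + e + 1 join the polynomial; the
    former vanishes in the last row, where the product is zero. Above the diagonal, the row weight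
    completes \<open>lowfac\<close> instead.\<close>
  let ?l = "\<lambda>e c. (of_nat (Suc e) + 1 * of_nat c) * ((of_nat n - of_nat (Suc e) + (- 1) * of_nat c) * q e c)"
  have l: "ldc (Suc (Suc j) - e) (?l e) 0" for e
    by (intro ldc_mult_linear_trunc X(3))
  show ?thesis
  proof (rule band_formI)
    fix d
    show "ldc (Suc (Suc j) - d) (case d of 0 \<Rightarrow> ?l 0 | Suc d' \<Rightarrow> p d') 0"
      using l[of 0] X(1) by (auto split: nat.split simp del: ldc.simps)
    show "ldc (Suc j - d) (?l (Suc d)) 0" using l[of "Suc d"] by simp
  next
    fix d r assume rd: "r + d < n"
    show "(sl2_E n * X) $$ (r, r + d)
        = lowfac (r + d) d * (case d of 0 \<Rightarrow> ?l 0 | Suc d' \<Rightarrow> p d') (r + d)"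
    proof (cases d)
      case 0
      then show ?thesis
      proof (cases "Suc r < n")
        case True
        then show ?thesis using 0 X(4)[of r 0]
          by (simp add: EX lowfac_def upfac_def, (simp add: algebra_simps)?)
      next
        case False
        then have "n = Suc r" using rd by simp
        then show ?thesis using 0 EX[of r r] by simp
      qed
    next
      case (Suc d')
      then show ?thesis using rd X(2)[of "Suc r" d']
        by (simp add: EX lowfac_def, (simp add: algebra_simps)?)
    qed
  next
    fix e c assume ce: "Suc (c + e) < n"
    show "(sl2_E n * X) $$ (Suc (c + e), c) = upfac n c (Suc e) * ?l (Suc e) c"
    proof (cases "Suc (Suc (c + e)) < n")
      case True
      then show ?thesis using X(4)[of c "Suc e"]
        by (simp add: EX upfac_def, (simp add: algebra_simps)?)
    next
      case False
      then have "n = Suc (Suc (c + e))" using ce by simp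
      then show ?thesis using EX[of "Suc (c + e)" c] by simp
    qed
  qed
qed

lemma band_form_F:
  assumes "X \<in> carrier_mat n n" "band_form n j X"
  shows "band_form n (Suc j) (sl2_F n * X)"
proof -
  obtain p q where X: "\<And>d. ldc (Suc j - d) (p d) 0"
    "\<And>d r. r + d < n \<Longrightarrow> X $$ (r, r + d) = lowfac (r + d) d * p d (r + d)"
    "\<And>e. ldc (j - e) (q e) 0"
    "\<And>e c. Suc (c + e) < n \<Longrightarrow> X $$ (Suc (c + e), c) = upfac n c (Suc e) * q e c"
    using band_formE[OF assms(2)] by metis
  have F0: "(sl2_F n * X) $$ (0, c) = 0" if "0 < n" "c < n" for c
    using that assms(1)
    by (subst index_mult_mat_single[where t = n and n = n]) (auto simp: sl2_F_def)
  have FX: "(sl2_F n * X) $$ (Suc r, c) = (of_nat n - of_nat (Suc r)) * X $$ (r, c)"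
    if "Suc r < n" "c < n" for r c
    using that assms(1)
    by (subst index_mult_mat_single[where t = r and n = n]) (auto simp: sl2_F_def)
  \<comment> \<open>Mirror image of the case of E: the surplus factor of \<open>lowfac\<close> is c
    - d and the row weight is n + d - c. The factor c - d vanishes in row 0, where the product is
    zero.\<close>
  let ?l = "\<lambda>d c. (- of_nat d + 1 * of_nat c) * ((of_nat n + of_nat d + (- 1) * of_nat c) * p (Suc d) c)"
  have l: "ldc (Suc (Suc j) - d) (?l d) 0" for d
    using X(1)[of "Suc d"] by (intro ldc_mult_linear_trunc) simp
  show ?thesis
  proof (rule band_formI)
    fix d
    show "ldc (Suc (Suc j) - d) (?l d) 0" by (rule l)
    show "ldc (Suc j - d) (case d of 0 \<Rightarrow> p 0 | Suc d' \<Rightarrow> q d') 0"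
      using X(1)[of 0] X(3) by (auto split: nat.split simp del: ldc.simps)
  next
    fix d r assume rd: "r + d < n"
    show "(sl2_F n * X) $$ (r, r + d) = lowfac (r + d) d * ?l d (r + d)"
    proof (cases r)
      case (Suc r')
      then show ?thesis using rd X(2)[of r' "Suc d"]
        by (simp add: FX lowfac_def, (simp add: algebra_simps)?)
    qed (use rd F0 in auto)
  next
    fix e c assume ce: "Suc (c + e) < n"
    show "(sl2_F n * X) $$ (Suc (c + e), c) = upfac n c (Suc e) * (case e of 0 \<Rightarrow> p 0 | Suc d' \<Rightarrow> q d') c"
    proof (cases e)
      case 0
      then show ?thesis using ce X(2)[of c 0]
        by (simp add: FX upfac_def lowfac_def, (simp add: algebra_simps)?)
    next
      case (Suc e')
      then show ?thesis using ce X(4)[of c e']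
        by (simp add: FX upfac_def, (simp add: algebra_simps)?)
    qed
  qed
qed

lemma sl2_filt_band_form: "sl2_filt n j X \<Longrightarrow> band_form n j X"
proof (induction rule: sl2_filt.induct)
  case (one j)
  show ?case
  proof (rule band_formI)
    fix d
    show "ldc (Suc j - d) (\<lambda>i. if d = 0 then 1 else 0) (0 :: 'a)"
      using ldc_mono[of "Suc 0" "Suc j" "\<lambda>i. 1 :: 'a"] by (cases d) (auto simp: ldc_zero fdiff_def[abs_def])
    show "ldc (j - d) (\<lambda>i. 0) (0 :: 'a)" by (rule ldc_zero)
  qed (auto simp: lowfac_def)
next
  case (add j X Y)
  note c = add.hyps(1,2)[THEN sl2_filt_carrier]
  obtain p q where X: "\<And>d. ldc (Suc j - d) (p d) 0"
    "\<And>d r. r + d < n \<Longrightarrow> X $$ (r, r + d) = lowfac (r + d) d * p d (r + d)"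
    "\<And>e. ldc (j - e) (q e) 0"
    "\<And>e c. Suc (c + e) < n \<Longrightarrow> X $$ (Suc (c + e), c) = upfac n c (Suc e) * q e c"
    using band_formE[OF add.IH(1)] by metis
  obtain p' q' where Y: "\<And>d. ldc (Suc j - d) (p' d) 0"
    "\<And>d r. r + d < n \<Longrightarrow> Y $$ (r, r + d) = lowfac (r + d) d * p' d (r + d)"
    "\<And>e. ldc (j - e) (q' e) 0"
    "\<And>e c. Suc (c + e) < n \<Longrightarrow> Y $$ (Suc (c + e), c) = upfac n c (Suc e) * q' e c"
    using band_formE[OF add.IH(2)] by metis
  show ?case
  proof (rule band_formI)
    fix d
    show "ldc (Suc j - d) (\<lambda>i. p d i + p' d i) 0" using ldc_add[OF X(1) Y(1)] by simp
    show "ldc (j - d) (\<lambda>i. q d i + q' d i) 0" using ldc_add[OF X(3) Y(3)] by simp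
  qed (use c in \<open>auto simp: X(2,4) Y(2,4) distrib_left\<close>)
next
  case (smult j X c)
  note C = sl2_filt_carrier[OF smult.hyps]
  obtain p q where X: "\<And>d. ldc (Suc j - d) (p d) 0"
    "\<And>d r. r + d < n \<Longrightarrow> X $$ (r, r + d) = lowfac (r + d) d * p d (r + d)"
    "\<And>e. ldc (j - e) (q e) 0"
    "\<And>e c. Suc (c + e) < n \<Longrightarrow> X $$ (Suc (c + e), c) = upfac n c (Suc e) * q e c"
    using band_formE[OF smult.IH] by metis
  show ?case
  proof (rule band_formI)
    fix d
    show "ldc (Suc j - d) (\<lambda>i. c * p d i) 0" using ldc_cmult[OF X(1)] by simp
    show "ldc (j - d) (\<lambda>i. c * q d i) 0" using ldc_cmult[OF X(3)] by simp
  qed (use C in \<open>auto simp: X(2,4)\<close>)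
next
  case (mult G j X)
  then show ?case
    using band_form_E band_form_F band_form_H sl2_filt_carrier by blast
qed

lemma sl2_filt_superdiag:
  assumes "sl2_filt n (Suc j) X"
  obtains q where "ldc (Suc j) q 0" "\<And>i. Suc i < n \<Longrightarrow> X $$ (i, Suc i) = of_nat (Suc i) * q (Suc i)"
proof -
  obtain p q where X: "\<And>d. ldc (Suc (Suc j) - d) (p d) 0"
    "\<And>d r. r + d < n \<Longrightarrow> X $$ (r, r + d) = lowfac (r + d) d * p d (r + d)"
    using band_formE[OF sl2_filt_band_form[OF assms]] by metis
  show thesis using X(1)[of 1] X(2)[of _ 1] by (intro that[of "p 1"]) (auto simp: lowfac_def)
qed

section \<open>An upper bound for the Lie algebra, and conjugation by diagonal matrices\<close>

context k_algebra
begin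

text \<open>Differencing lowers \<open>j\<close> and raises \<open>p\<close>, so
  \<open>j + p\<close> is constant and the same \<open>c\<close> serves at each step; once the
  degree is exhausted the difference is 0.\<close>

lemma filt_scale_const:
  assumes "ldc (Suc j) q 0" "c \<in> I (j + p)"
  shows "filt N p (\<lambda>i. scale (q i) c)"
  using assms
proof (induction N arbitrary: j p q)
  case (Suc N)
  have "scale (q i) c \<in> I p" for i
    using ideal_I_scale ideal_I_antimono[of p "j + p"] Suc.prems(2) by auto
  moreover have eq: "fdiff (\<lambda>i. scale (q i) c) = (\<lambda>i. scale (fdiff q i) c)"
    by (simp add: fdiff_def fun_eq_iff scale_left_diff_distrib)
  have "filt N (Suc p) (\<lambda>i. scale (fdiff q i) c)"
  proof (cases j)
    case 0
    then show ?thesis using Suc.prems(1) by (simp add: filt_zero)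
  next
    case (Suc j')
    then show ?thesis using Suc.prems Suc.IH[of j' "fdiff q" "Suc p"] by simp
  qed
  ultimately show ?case by (simp add: eq)
qed simp

lemma tensor_mat_carrier [simp]: "tensor_mat scale b X \<in> carrier_mat n m \<longleftrightarrow> X \<in> carrier_mat n m"
  by (auto simp: tensor_mat_def)

lemma tensor_space_induct:
  assumes "X \<in> tensor_space scale n (sl2_mats n)"
    and zero: "P (0\<^sub>m n n)"
    and add: "\<And>X Y. X \<in> carrier_mat n n \<Longrightarrow> Y \<in> carrier_mat n n \<Longrightarrow> P X \<Longrightarrow> P Y \<Longrightarrow> P (X + Y)"
    and scale: "\<And>c X. X \<in> carrier_mat n n \<Longrightarrow> P X \<Longrightarrow> P (map_mat (scale c) X)"
    and gens: "\<And>b. P (tensor_mat scale b (sl2_E n))" "\<And>b. P (tensor_mat scale b (sl2_F n))"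
      "\<And>b. P (tensor_mat scale b (sl2_H n))"
  shows "P X"
proof -
  have pure: "P (tensor_mat scale b Y)" if "Y \<in> sl2_mats n" for b Y
    using that unfolding sl2_mats_def
  proof (induction rule: mat_span.induct)
    case zero
    have "tensor_mat scale b (0\<^sub>m n n) = 0\<^sub>m n n" by (auto simp: tensor_mat_def intro!: eq_matI)
    then show ?case using assms(2) by simp
  next
    case (base X)
    then show ?case using gens by auto
  next
    case (add X Y)
    then have c: "X \<in> carrier_mat n n" "Y \<in> carrier_mat n n"
      using sl2_mats_carrier by (auto simp: sl2_mats_def)
    then have "tensor_mat scale b (X + Y) = tensor_mat scale b X + tensor_mat scale b Y"
      by (auto simp: tensor_mat_def scale_left_distrib intro!: eq_matI)
    then show ?case using add.IH c assms(3) by (simp add: tensor_mat_def)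
  next
    case (scale X a)
    then have c: "X \<in> carrier_mat n n" using sl2_mats_carrier by (auto simp: sl2_mats_def)
    have "tensor_mat scale b (map_mat ((*) a) X) = map_mat (scale a) (tensor_mat scale b X)"
      by (auto simp: tensor_mat_def intro!: eq_matI)
    then show ?case using scale.IH c assms(4) by (simp add: tensor_mat_def)
  qed
  have "X \<in> carrier_mat n n \<and> P X"
    using assms(1) unfolding tensor_space_def
  proof (induction rule: mat_span.induct)
    case (base X)
    then show ?case using pure sl2_mats_carrier by auto
  qed (use zero add scale in auto)
  then show ?thesis by simp
qed

lemma map_mat_scale_mult:
  assumes "X \<in> carrier_mat n n" "Y \<in> carrier_mat n n"
  shows "map_mat (scale a) X * Y = map_mat (scale a) (X * Y)"
    and "Y * map_mat (scale a) X = map_mat (scale a) (Y * X)"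
  using assms
  by (auto intro!: eq_matI simp: index_mult_mat_sum[of _ n] scale_mult scale_sum_right
      simp del: index_mult_mat(1))

lemma tensor_mat_mult:
  assumes "X \<in> carrier_mat n n" "Y \<in> carrier_mat n n"
  shows "tensor_mat scale c X * tensor_mat scale d Y = tensor_mat scale (c * d) (X * Y)"
proof (rule eq_matI)
  fix i j assume "i < dim_row (tensor_mat scale (c * d) (X * Y))"
    "j < dim_col (tensor_mat scale (c * d) (X * Y))"
  then have ij: "i < n" "j < n" using assms by (auto simp: tensor_mat_def)
  have "(tensor_mat scale c X * tensor_mat scale d Y) $$ (i, j)
      = (\<Sum>s<n. tensor_mat scale c X $$ (i, s) * tensor_mat scale d Y $$ (s, j))"
    using assms ij by (intro index_mult_mat_sum) auto
  also have "\<dots> = (\<Sum>s<n. scale (X $$ (i, s) * Y $$ (s, j)) (c * d))"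
    using assms ij by (intro sum.cong) (auto simp: tensor_mat_def scale_mult mult.commute)
  also have "\<dots> = scale ((X * Y) $$ (i, j)) (c * d)"
    unfolding index_mult_mat_sum[OF assms ij] by (simp add: scale_sum_left)
  finally show "(tensor_mat scale c X * tensor_mat scale d Y) $$ (i, j)
      = tensor_mat scale (c * d) (X * Y) $$ (i, j)"
    using assms ij by (simp add: tensor_mat_def)
qed (use assms in \<open>auto simp: tensor_mat_def\<close>)

section \<open>The Lie algebra that bounds L from above\<close>

definition lie_bound :: "nat \<Rightarrow> 'f mat set" where
  "lie_bound n = mat_span scale n {tensor_mat scale c X | c X j. c \<in> I j \<and> sl2_filt n (Suc j) X}"

lemma lie_bound_carrier: "X \<in> lie_bound n \<Longrightarrow> X \<in> carrier_mat n n"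
  unfolding lie_bound_def by (erule mat_span_carrier) (auto dest: sl2_filt_carrier)

lemma lie_bound_closed:
  "0\<^sub>m n n \<in> lie_bound n"
  "X \<in> lie_bound n \<Longrightarrow> Y \<in> lie_bound n \<Longrightarrow> X + Y \<in> lie_bound n"
  "X \<in> lie_bound n \<Longrightarrow> map_mat (scale a) X \<in> lie_bound n"
  by (auto simp: lie_bound_def intro: mat_span.intros)

lemma lie_bound_base: "c \<in> I j \<Longrightarrow> sl2_filt n (Suc j) X \<Longrightarrow> tensor_mat scale c X \<in> lie_bound n"
  unfolding lie_bound_def by (rule mat_span.base) blast

lemma lie_bound_induct [consumes 1, case_names zero base add scale]:
  assumes "X \<in> lie_bound n" "P (0\<^sub>m n n)"
    "\<And>c Y j. c \<in> I j \<Longrightarrow> sl2_filt n (Suc j) Y \<Longrightarrow> P (tensor_mat scale c Y)"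
    "\<And>X Y. X \<in> lie_bound n \<Longrightarrow> Y \<in> lie_bound n \<Longrightarrow> P X \<Longrightarrow> P Y \<Longrightarrow> P (X + Y)"
    "\<And>X a. X \<in> lie_bound n \<Longrightarrow> P X \<Longrightarrow> P (map_mat (scale a) X)"
  shows "P X"
  using assms(1) unfolding lie_bound_def
proof (induction rule: mat_span.induct)
  case (base X)
  then show ?case using assms(3) by blast
qed (use assms(2,4,5) in \<open>auto simp: lie_bound_def\<close>)

lemma mat_comm_scale_left:
  assumes "X \<in> carrier_mat n n" "Y \<in> carrier_mat n n"
  shows "map_mat (scale a) X * Y - Y * map_mat (scale a) X = map_mat (scale a) (X * Y - Y * X)"
  unfolding map_mat_scale_mult[OF assms]
  using assms by (auto intro!: eq_matI simp: scale_right_diff_distrib simp del: index_mult_mat(1))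

lemma lie_bound_swap:
  assumes "X * Y - Y * X \<in> lie_bound n" "X \<in> carrier_mat n n" "Y \<in> carrier_mat n n"
  shows "Y * X - X * Y \<in> lie_bound n"
proof -
  have "Y * X - X * Y = map_mat (scale (- 1)) (X * Y - Y * X)"
    using assms(2,3) by (auto intro!: eq_matI simp del: index_mult_mat(1))
  then show ?thesis using assms(1) lie_bound_closed(3) by simp
qed

lemma lie_bound_bracket_base:
  assumes X: "c \<in> I a" "sl2_filt n (Suc a) X" and Y: "d \<in> I b" "sl2_filt n (Suc b) Y"
  shows "tensor_mat scale c X * tensor_mat scale d Y - tensor_mat scale d Y * tensor_mat scale c X
    \<in> lie_bound n"
proof -
  note C = sl2_filt_carrier[OF X(2)] sl2_filt_carrier[OF Y(2)]
  have "tensor_mat scale c X * tensor_mat scale d Y - tensor_mat scale d Y * tensor_mat scale c X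
      = tensor_mat scale (c * d - d * c) (X * Y) + tensor_mat scale (d * c) (X * Y - Y * X)"
    unfolding tensor_mat_mult[OF C] tensor_mat_mult[OF C(2,1)]
    using C by (auto intro!: eq_matI
        simp: tensor_mat_def scale_right_diff_distrib scale_left_diff_distrib simp del: index_mult_mat(1))
  moreover have "tensor_mat scale (c * d - d * c) (X * Y) \<in> lie_bound n"
    using ideal_I_comm[OF X(1) Y(1)] sl2_filt_mult[OF X(2) Y(2)] by (intro lie_bound_base) simp_all
  moreover have "tensor_mat scale (d * c) (X * Y - Y * X) \<in> lie_bound n"
    using ideal_I_mult[OF Y(1) X(1)] sl2_filt_comm[OF X(2) Y(2)]
    by (intro lie_bound_base[of _ "a + b"]) (simp_all add: add.commute)
  ultimately show ?thesis using lie_bound_closed(2) by simp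
qed

lemma lie_bound_bracket:
  assumes "X \<in> lie_bound n" "Y \<in> lie_bound n"
  shows "X * Y - Y * X \<in> lie_bound n"
proof -
  have bracket_zero: "0\<^sub>m n n * Y - Y * 0\<^sub>m n n \<in> lie_bound n" if "Y \<in> carrier_mat n n" for Y :: "'f mat"
  proof -
    have "0\<^sub>m n n * Y - Y * 0\<^sub>m n n = 0\<^sub>m n n" using that by simp
    then show ?thesis using lie_bound_closed(1) by metis
  qed
  have bracket_pure: "tensor_mat scale c X * Y - Y * tensor_mat scale c X \<in> lie_bound n"
    if c: "c \<in> I j" and X: "sl2_filt n (Suc j) X" for c X j
  proof -
    have TX: "tensor_mat scale c X \<in> carrier_mat n n" using sl2_filt_carrier[OF X] by simp
    \<comment> \<open>Reversed order, so that the varying \<open>Y\<close> stands on the left, where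
      the linearity lemmas apply; \<open>lie_bound_swap\<close> turns it back.\<close>
    from assms(2) have "Y * tensor_mat scale c X - tensor_mat scale c X * Y \<in> lie_bound n"
    proof (induction rule: lie_bound_induct)
      case zero
      then show ?case by (rule bracket_zero[OF TX])
    next
      case (base d Y j)
      show ?case by (rule lie_bound_bracket_base[OF base c X])
    next
      case (add Y Y')
      then show ?case
        unfolding mat_comm_add_left[OF add.hyps(1,2)[THEN lie_bound_carrier] TX]
        by (intro lie_bound_closed)
    next
      case (scale Y a)
      then show ?case
        unfolding mat_comm_scale_left[OF scale.hyps[THEN lie_bound_carrier] TX]
        by (intro lie_bound_closed)
    qed
    then show ?thesis by (rule lie_bound_swap[OF _ lie_bound_carrier[OF assms(2)] TX])
  qed
  from assms(1) show ?thesis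
  proof (induction rule: lie_bound_induct)
    case zero
    then show ?case by (rule bracket_zero[OF lie_bound_carrier[OF assms(2)]])
  next
    case (base c X j)
    then show ?case by (rule bracket_pure)
  next
    case (add X X')
    then show ?case
      unfolding mat_comm_add_left[OF add.hyps(1,2)[THEN lie_bound_carrier] lie_bound_carrier[OF assms(2)]]
      by (intro lie_bound_closed)
  next
    case (scale X a)
    then show ?case
      unfolding mat_comm_scale_left[OF scale.hyps[THEN lie_bound_carrier] lie_bound_carrier[OF assms(2)]]
      by (intro lie_bound_closed)
  qed
qed

lemma lie_alg_le_bound: "X \<in> L n \<Longrightarrow> X \<in> lie_bound n"
  unfolding lie_alg_def
proof (induction rule: lie_generated.induct)
  case (base X)
  have gen: "tensor_mat scale b G \<in> lie_bound n" if "G \<in> {sl2_E n, sl2_F n, sl2_H n}" for b G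
    using sl2_filt.mult[OF that sl2_filt.one[of n 0]] sl2_gen_carrier[OF that]
    by (intro lie_bound_base[of b 0]) auto
  show ?case
    by (rule tensor_space_induct[OF base]) (auto intro: lie_bound_closed gen)
qed (auto intro: lie_bound_closed lie_bound_bracket)

text \<open>Only the superdiagonal is recorded: it suffices for testing whether D (1 (x) E) D^-1
  lies in L.\<close>

definition superdiag_filt :: "nat \<Rightarrow> 'f mat \<Rightarrow> bool" where
  "superdiag_filt n X \<longleftrightarrow> (\<exists>m. filt (n - 1) 0 (\<lambda>i. m (Suc i)) \<and>
     (\<forall>i. Suc i < n \<longrightarrow> X $$ (i, Suc i) = scale (of_nat (Suc i)) (m (Suc i))))"

lemma lie_bound_superdiag: "X \<in> lie_bound n \<Longrightarrow> superdiag_filt n X"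
proof (induction rule: lie_bound_induct)
  case zero
  then show ?case unfolding superdiag_filt_def
    by (intro exI[of _ "\<lambda>i. 0"]) (auto simp: filt_zero)
next
  case (base c Y j)
  obtain q where q: "ldc (Suc j) q 0" "\<And>i. Suc i < n \<Longrightarrow> Y $$ (i, Suc i) = of_nat (Suc i) * q (Suc i)"
    using sl2_filt_superdiag[OF base(2)] by metis
  then show ?case unfolding superdiag_filt_def
    using sl2_filt_carrier[OF base(2)] base(1)
    by (intro exI[of _ "\<lambda>i. scale (q i) c"])
      (auto simp: tensor_mat_def intro!: filt_scale_const ldc_shift simp del: ldc.simps)
next
  case (add X Y)
  then obtain m m' where "filt (n - 1) 0 (\<lambda>i. m (Suc i))"
     "\<And>i. Suc i < n \<Longrightarrow> X $$ (i, Suc i) = scale (of_nat (Suc i)) (m (Suc i))"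
     "filt (n - 1) 0 (\<lambda>i. m' (Suc i))"
     "\<And>i. Suc i < n \<Longrightarrow> Y $$ (i, Suc i) = scale (of_nat (Suc i)) (m' (Suc i))"
    unfolding superdiag_filt_def by blast
  then show ?case unfolding superdiag_filt_def
    using add.hyps(1,2)[THEN lie_bound_carrier]
    by (intro exI[of _ "\<lambda>i. m i + m' i"]) (auto simp: scale_right_distrib intro: filt_add)
next
  case (scale X a)
  then obtain m where "filt (n - 1) 0 (\<lambda>i. m (Suc i))"
     "\<And>i. Suc i < n \<Longrightarrow> X $$ (i, Suc i) = scale (of_nat (Suc i)) (m (Suc i))"
    unfolding superdiag_filt_def by blast
  then show ?case unfolding superdiag_filt_def
    using scale.hyps[THEN lie_bound_carrier]
    by (intro exI[of _ "\<lambda>i. scale a (m i)"])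
      (auto simp: mult.commute intro: filt_scale simp del: of_nat_Suc)
qed

lemma supm_mem_iff: "supm n m \<in> L n \<longleftrightarrow> filt (n - 1) 0 (\<lambda>i. m (Suc i))"
proof
  assume "supm n m \<in> L n"
  then have "superdiag_filt n (supm n m)" by (intro lie_bound_superdiag lie_alg_le_bound)
  then obtain m' where m': "filt (n - 1) 0 (\<lambda>i. m' (Suc i))"
    "\<And>i. Suc i < n \<Longrightarrow> scale (of_nat (Suc i)) (m (Suc i)) = scale (of_nat (Suc i)) (m' (Suc i))"
    unfolding superdiag_filt_def by (auto simp del: of_nat_Suc)
  \<comment> \<open>Characteristic 0 allows division by the weight i + 1.\<close>
  have "m (Suc i) = m' (Suc i)" if "i < n - 1" for i
    using m'(2)[of i] that of_nat_neq_0[of i, where 'a = 'k]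
    by (simp del: of_nat_Suc add: scale_cancel_left)
  then show "filt (n - 1) 0 (\<lambda>i. m (Suc i))"
    using m'(1) by (intro iffD2[OF filt_cong m'(1)])
qed (rule supm_mem)

section \<open>Conjugation by invertible diagonal matrices\<close>

definition conj_mat :: "nat \<Rightarrow> (nat \<Rightarrow> 'f) \<Rightarrow> (nat \<Rightarrow> 'f) \<Rightarrow> 'f mat \<Rightarrow> 'f mat" where
  "conj_mat n f g X = mat n n (\<lambda>(i, j). f i * X $$ (i, j) * g j)"

lemma conj_mat_eq:
  assumes "X \<in> carrier_mat n n"
  shows "mat_diag n f * X * mat_diag n g = conj_mat n f g X"
proof (rule eq_matI)
  fix i j assume "i < dim_row (conj_mat n f g X)" "j < dim_col (conj_mat n f g X)"
  then have ij: "i < n" "j < n" by (auto simp: conj_mat_def)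
  have "(mat_diag n f * X * mat_diag n g) $$ (i, j)
      = (\<Sum>s<n. (mat_diag n f * X) $$ (i, s) * mat_diag n g $$ (s, j))"
    using assms ij by (intro index_mult_mat_sum) (auto intro: mult_carrier_mat)
  also have "\<dots> = (\<Sum>s<n. if j = s then f i * X $$ (i, j) * g j else 0)"
    using assms ij by (intro sum.cong) (auto simp: index_band_mult simp del: index_mult_mat(1))
  finally show "(mat_diag n f * X * mat_diag n g) $$ (i, j) = conj_mat n f g X $$ (i, j)"
    using ij by (simp add: conj_mat_def)
qed (use assms in \<open>auto simp: conj_mat_def\<close>)

lemma conj_mat_mult:
  assumes "X \<in> carrier_mat n n" "Y \<in> carrier_mat n n" "\<And>i. i < n \<Longrightarrow> is_inverse (f i) (g i)"
  shows "conj_mat n f g (X * Y) = conj_mat n f g X * conj_mat n f g Y"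
proof (rule eq_matI)
  fix i j assume "i < dim_row (conj_mat n f g X * conj_mat n f g Y)"
    "j < dim_col (conj_mat n f g X * conj_mat n f g Y)"
  then have ij: "i < n" "j < n" by (auto simp: conj_mat_def)
  have "(conj_mat n f g X * conj_mat n f g Y) $$ (i, j)
      = (\<Sum>s<n. conj_mat n f g X $$ (i, s) * conj_mat n f g Y $$ (s, j))"
    using ij by (intro index_mult_mat_sum) (auto simp: conj_mat_def)
  also have "\<dots> = (\<Sum>s<n. f i * (X $$ (i, s) * Y $$ (s, j)) * g j)"
  proof (rule sum.cong)
    fix s assume "s \<in> {..<n}"
    moreover from this have "g s * (f s * x) = x" for x
      using assms(3)[of s] by (simp add: is_inverse_def mult.assoc[symmetric])
    ultimately show "conj_mat n f g X $$ (i, s) * conj_mat n f g Y $$ (s, j)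
        = f i * (X $$ (i, s) * Y $$ (s, j)) * g j"
      using ij by (simp add: conj_mat_def mult.assoc)
  qed simp
  finally show "conj_mat n f g (X * Y) $$ (i, j) = (conj_mat n f g X * conj_mat n f g Y) $$ (i, j)"
    using ij index_mult_mat_sum[OF assms(1,2) ij]
    by (simp add: conj_mat_def sum_distrib_left sum_distrib_right del: index_mult_mat(1))
qed (auto simp: conj_mat_def)

lemma conj_mat_linear:
  assumes "X \<in> carrier_mat n n" "Y \<in> carrier_mat n n"
  shows "conj_mat n f g (X + Y) = conj_mat n f g X + conj_mat n f g Y"
    and "conj_mat n f g (X - Y) = conj_mat n f g X - conj_mat n f g Y"
    and "conj_mat n f g (map_mat (scale a) X) = map_mat (scale a) (conj_mat n f g X)"
  using assms by (auto intro!: eq_matI simp: conj_mat_def algebra_simps scale_mult)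

lemma conj_mat_band:
  "conj_mat n f g (supm n m) = supm n (\<lambda>j. f (j - 1) * m j * g j)"
  "conj_mat n f g (subm n m) = subm n (\<lambda>j. f (Suc j) * m j * g j)"
  by (auto intro!: eq_matI simp: conj_mat_def scale_mult)

text \<open>Conjugation preserves brackets, so the generators suffice, and b (x) H =
  [b (x) E, 1 (x) F] reduces H to the two bands.\<close>

lemma conj_mat_lie_alg:
  assumes inv: "\<And>i. i < n \<Longrightarrow> is_inverse (f i) (g i)"
    and n: "n > 0" and r: "filt (n - 1) 0 (\<lambda>i. f i * g (Suc i))" and X: "X \<in> L n"
  shows "conj_mat n f g X \<in> L n"
proof -
  have inv': "is_inverse (f i) (g i)" if "i \<le> n - 1" for i using inv n that by simp
  have "conj_mat n f g (supm n (\<lambda>j. b)) \<in> L n" for b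
    using filt_conj_entries(1)[OF inv' r, of b] by (simp add: conj_mat_band supm_mem)
  moreover have "conj_mat n f g (subm n (\<lambda>j. b)) \<in> L n" for b
    using filt_conj_entries(2)[OF inv' r, of b] by (simp add: conj_mat_band subm_mem)
  ultimately have EF: "conj_mat n f g (tensor_mat scale b (sl2_E n)) \<in> L n"
    "conj_mat n f g (tensor_mat scale b (sl2_F n)) \<in> L n" for b
    by (simp_all add: tensor_sl2)
  have conj_bracket: "conj_mat n f g (X * Y - Y * X)
      = conj_mat n f g X * conj_mat n f g Y - conj_mat n f g Y * conj_mat n f g X"
    if "X \<in> carrier_mat n n" "Y \<in> carrier_mat n n" for X Y
    using that conj_mat_mult[OF that inv] conj_mat_mult[OF that(2,1) inv]
      conj_mat_linear(2)[OF mult_carrier_mat[OF that] mult_carrier_mat[OF that(2,1)]]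
    by simp
  have H: "conj_mat n f g (tensor_mat scale b (sl2_H n)) \<in> L n" for b
  proof -
    have eq: "tensor_mat scale b (sl2_H n) = tensor_mat scale b (sl2_E n) * tensor_mat scale 1 (sl2_F n)
        - tensor_mat scale 1 (sl2_F n) * tensor_mat scale b (sl2_E n)"
    proof -
      have "hwt n i = of_nat (Suc i) * (of_nat n - of_nat (Suc i)) - of_nat i * (of_nat n - of_nat i)"
        for i by (simp add: hwt_def algebra_simps)
      then show ?thesis
        by (simp only: tensor_sl2 supm_comm_subm scale_left_diff_distrib mult_1_left mult_1_right)
    qed
    have c: "tensor_mat scale b (sl2_E n) \<in> carrier_mat n n" "tensor_mat scale 1 (sl2_F n) \<in> carrier_mat n n"
      by auto
    show ?thesis
      unfolding eq conj_bracket[OF c] by (intro lie_alg_closed EF)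
  qed
  have conj_zero: "conj_mat n f g (0\<^sub>m n n) = 0\<^sub>m n n"
    by (auto intro!: eq_matI simp: conj_mat_def)
  have "X \<in> L n \<and> conj_mat n f g X \<in> L n"
    using X unfolding lie_alg_def
  proof (induction rule: lie_generated.induct)
    case (base X)
    have "conj_mat n f g X \<in> L n"
      by (rule tensor_space_induct[OF base])
        (auto simp: EF H conj_zero conj_mat_linear intro: lie_alg_closed)
    then show ?case using base by (auto simp: lie_alg_def intro: lie_generated.base)
  next
    case (bracket X Y)
    then have c: "X \<in> carrier_mat n n" "Y \<in> carrier_mat n n"
      using lie_alg_carrier by (auto simp: lie_alg_def)
    show ?case
      unfolding conj_bracket[OF c] using bracket by (auto intro: lie_generated.bracket)
  next
    case (add X Y)
    then have c: "X \<in> carrier_mat n n" "Y \<in> carrier_mat n n"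
      using lie_alg_carrier by (auto simp: lie_alg_def)
    then show ?case using add by (auto simp: conj_mat_linear intro: lie_generated.add)
  next
    case (scale X c)
    then have c: "X \<in> carrier_mat n n"
      using lie_alg_carrier by (auto simp: lie_alg_def)
    then show ?case using scale by (auto simp: conj_mat_linear intro: lie_generated.scale)
  qed (auto simp: conj_zero intro: lie_generated.zero)
  then show ?thesis by simp
qed

lemma conj_mat_cancel:
  assumes "\<And>i. i < n \<Longrightarrow> is_inverse (f i) (g i)" "X \<in> carrier_mat n n"
  shows "conj_mat n f g (conj_mat n g f X) = X"
proof (rule eq_matI)
  fix i j assume "i < dim_row X" "j < dim_col X"
  then have ij: "i < n" "j < n" using assms(2) by auto
  then have "f i * (g i * x) = x" "f j * g j = 1" for x
    using assms(1)[of i] assms(1)[of j] by (simp_all add: is_inverse_def mult.assoc[symmetric])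
  then show "conj_mat n f g (conj_mat n g f X) $$ (i, j) = X $$ (i, j)"
    using ij by (simp add: conj_mat_def mult.assoc)
qed (use assms(2) in \<open>auto simp: conj_mat_def\<close>)

lemma mat_diag_inverse:
  assumes "\<And>i. i < n \<Longrightarrow> is_inverse (f i) (g i)"
  shows "mat_diag n f * mat_diag n g = 1\<^sub>m n"
  using assms
  by (auto intro!: eq_matI simp: index_band_mult is_inverse_def simp del: index_mult_mat(1))

text \<open>\<open>lie_group\<close> quantifies over the inverse; identifying it with the entrywise
  inverse turns its conjugation into \<open>conj_mat\<close>.\<close>

lemma mat_diag_right_inverse_unique:
  fixes h :: "'f mat"
  assumes "\<And>i. i < n \<Longrightarrow> is_inverse (f i) (g i)"
    and "h \<in> carrier_mat n n" "mat_diag n f * h = 1\<^sub>m n"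
  shows "h = mat_diag n g"
proof (rule eq_matI)
  fix i j assume "i < dim_row (mat_diag n g)" "j < dim_col (mat_diag n g)"
  then have ij: "i < n" "j < n" by auto
  have "f i * h $$ (i, j) = 1\<^sub>m n $$ (i, j)"
    using index_band_mult(3)[OF assms(2) ij, of f] assms(3) by simp
  then have "g i * (f i * h $$ (i, j)) = g i * 1\<^sub>m n $$ (i, j)" by simp
  then have "h $$ (i, j) = g i * 1\<^sub>m n $$ (i, j)"
    using assms(1)[OF ij(1)] by (simp add: is_inverse_def mult.assoc[symmetric])
  then show "h $$ (i, j) = mat_diag n g $$ (i, j)" using ij by auto
qed (use assms(2) in auto)

lemma diag_mem_lie_group_iff:
  assumes inv: "\<And>i. i < n \<Longrightarrow> is_inverse (f i) (g i)" and n: "n > 0"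
  shows "mat_diag n f \<in> lie_group scale n (sl2_mats n) \<longleftrightarrow> filt (n - 1) 0 (\<lambda>i. f i * g (Suc i))"
proof
  assume "mat_diag n f \<in> lie_group scale n (sl2_mats n)"
  then obtain h where h: "h \<in> carrier_mat n n" "mat_diag n f * h = 1\<^sub>m n"
    and im: "(\<lambda>y. mat_diag n f * y * h) ` L n = L n"
    by (auto simp: lie_group_def)
  have "mat_diag n f * supm n (\<lambda>j. 1) * h \<in> L n" using im gens_mem(1) by blast
  then have "conj_mat n f g (supm n (\<lambda>j. 1)) \<in> L n"
    using mat_diag_right_inverse_unique[OF inv h] conj_mat_eq by simp
  then show "filt (n - 1) 0 (\<lambda>i. f i * g (Suc i))"
    by (simp add: conj_mat_band supm_mem_iff)
next
  assume r: "filt (n - 1) 0 (\<lambda>i. f i * g (Suc i))"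
  have inv': "is_inverse (g i) (f i)" if "i < n" for i
    by (rule is_inverse_sym[OF inv[OF that]])
  have r': "filt (n - 1) 0 (\<lambda>i. g i * f (Suc i))"
    by (rule filt_conj_inverse(2)[OF inv r]) (use n in simp)
  have "(\<lambda>y. mat_diag n f * y * mat_diag n g) ` L n = L n"
  proof (intro equalityI subsetI)
    fix X assume "X \<in> (\<lambda>y. mat_diag n f * y * mat_diag n g) ` L n"
    then show "X \<in> L n"
      using conj_mat_lie_alg[OF inv n r] conj_mat_eq lie_alg_carrier by auto
  next
    fix X assume X: "X \<in> L n"
    \<comment> \<open>Surjectivity: the preimage is the conjugate by the inverse matrix, which stays
      in L because of \<open>r'\<close>.\<close>
    have "X = mat_diag n f * conj_mat n g f X * mat_diag n g"
      using conj_mat_cancel[OF inv lie_alg_carrier[OF X]]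
      by (simp add: conj_mat_eq conj_mat_def)
    then show "X \<in> (\<lambda>y. mat_diag n f * y * mat_diag n g) ` L n"
      using conj_mat_lie_alg[OF inv' n r' X] by blast
  qed
  then show "mat_diag n f \<in> lie_group scale n (sl2_mats n)"
    using mat_diag_inverse[OF inv] mat_diag_inverse[OF inv']
    by (auto simp: lie_group_def intro!: bexI[of _ "mat_diag n g"])
qed

end

text \<open>Uniqueness of two-sided inverses makes the definite description in
  \<open>ring_inv\<close> meaningful.\<close>

lemma is_inverse_ring_inv:
  assumes "x \<in> ring_units"
  shows "is_inverse x (ring_inv x)"
proof -
  obtain y where y: "is_inverse x y" using assms by (auto simp: ring_units_def)
  have "z = y" if "is_inverse x z" for z
  proof -
    have "z = (y * x) * z" using y by (simp add: is_inverse_def)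
    also have "\<dots> = y" using that by (simp add: is_inverse_def mult.assoc)
    finally show ?thesis .
  qed
  with y show ?thesis unfolding ring_inv_def by (rule theI)
qed

theorem theorem5p12:
  fixes scale :: "'k::field_char_0 \<Rightarrow> 'f::{ring,monoid_mult} \<Rightarrow> 'f"
    and n :: nat
    and f :: "nat \<Rightarrow> 'f"
  assumes "k_algebra scale"
    and "n \<ge> 2"
    and "\<forall>i\<in>{1..n}. f i \<in> ring_units"
  shows "mat_diag n (\<lambda>i. f (i + 1)) \<in> lie_group scale n (sl2_mats n)
    \<longleftrightarrow> (\<forall>k\<in>{1..n - 2}. Delta scale k (\<lambda>i. f i * ring_inv (f (i + 1))) \<in> ideal_I scale k)"
proof -
  interpret k_algebra scale by (rule assms(1))
  have "is_inverse (f (i + 1)) (ring_inv (f (i + 1)))" if "i < n" for i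
    using assms(3) that by (intro is_inverse_ring_inv) simp
  then have "mat_diag n (\<lambda>i. f (i + 1)) \<in> lie_group scale n (sl2_mats n)
      \<longleftrightarrow> filt (n - 1) 0 (\<lambda>i. f (i + 1) * ring_inv (f (Suc i + 1)))"
    using assms(2) by (intro diag_mem_lie_group_iff) auto
  also have "\<dots> \<longleftrightarrow> (\<forall>k\<in>{1..n - 2}. Delta scale k (\<lambda>i. f i * ring_inv (f (i + 1))) \<in> ideal_I scale k)"
    using filt_iff_Delta[of "n - 1" "\<lambda>i. f i * ring_inv (f (i + 1))"]
    by (simp add: numeral_2_eq_2)
  finally show ?thesis .
qed

end
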